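(* For $n\in\mathbb N$ define $$S_n(x)=\sum_{k=0}^n\binom nk^2\binom{2k}k(2k+1)x^k,\qquad S_n=S_n(1).$$ (i) For any positive integer $n$, $$\frac1{n^2}\sum_{k=0}^{n-1}S_k=\sum_{k=0}^{n-1}\binom{n-1}k^2C_k\in\mathbb Z,$$ where $C_k=\binom{2k}k/(k+1)$ is the $k$-th Catalan number, and $$\frac1n\sum_{k=0}^{n-1}S_k(x)\in\mathbb Z[x].$$ (ii) For any prime $p>3$, $$\sum_{k=1}^{p-1}\frac{S_k}k\equiv p\sum_{k=1}^{p-1}\frac{S_k}{k^2}\equiv-\frac p2\left(\frac p3\right)B_{p-2}\left(\frac13\right)\pmod{p^2},$$ where $B_m(x)$ denotes the Bernoulli polynomial of degree $m$.
   Context: $\left(\frac{\cdot}{3}\right)$ is the Legendre symbol. Congruences are in the ring of rational numbers with denominator prime to $p$. *)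

theory Defs
  imports "HOL-Computational_Algebra.Polynomial" "HOL-Number_Theory.Residues"
begin

definition S_poly :: "nat \<Rightarrow> rat poly" where
  "S_poly n =
     (\<Sum>k=0..n. Polynomial.monom (of_nat ((n choose k)\<^sup>2 * ((2*k) choose k) * (2*k + 1))) k)"

definition S :: "nat \<Rightarrow> rat" where
  "S n = poly (S_poly n) 1"

definition catalan :: "nat \<Rightarrow> rat" where
  "catalan k = of_nat ((2*k) choose k) / of_nat (k + 1)"

text \<open>The standard recurrence \<open>\<Sum>k\<le>m. (m+1 choose k) * B k = 0\<close> for \<open>m > 0\<close>, solved for
  \<open>B m\<close>; in particular \<open>B 1 = -1/2\<close>.\<close>

fun bernoulli :: "nat \<Rightarrow> rat" where
  "bernoulli 0 = 1"
| "bernoulli (Suc n) =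
     - (\<Sum>k\<le>n. of_nat ((n + 2) choose k) * bernoulli k) / of_nat (n + 2)"

declare bernoulli.simps(2) [simp del]

definition bernoulli_poly :: "nat \<Rightarrow> rat poly" where
  "bernoulli_poly n = (\<Sum>k\<le>n. Polynomial.monom (of_nat (n choose k) * bernoulli k) (n - k))"

definition int_polys :: "rat poly set" where
  "int_polys = range (map_poly of_int)"

text \<open>The rationals whose reduced denominator is prime to \<open>p\<close>.\<close>

definition local_ints :: "nat \<Rightarrow> rat set" where
  "local_ints p = {x. coprime (snd (quotient_of x)) (int p)}"

text \<open>Congruence modulo \<open>m\<close> in the ring \<open>local_ints p\<close>; both sides are required to
  belong to that ring.\<close>

definition rat_cong :: "nat \<Rightarrow> rat \<Rightarrow> rat \<Rightarrow> nat \<Rightarrow> bool" where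
  "rat_cong p a b m \<longleftrightarrow>
     a \<in> local_ints p \<and> b \<in> local_ints p \<and> (\<exists>c \<in> local_ints p. a - b = of_nat m * c)"

end

theory Submission
  imports Defs "HOL-Computational_Algebra.Formal_Power_Series"
begin

text \<open>
  For the first part, \<open>(n choose k)\<^sup>2 * (2 * k choose k)\<close> is a sum of squares of trinomial
  coefficients. Their symmetry yields \<open>(\<Sum>k\<le>n. (2 * n - 3 * k) * (n choose k)\<^sup>2 * (2 * k choose
  k)) = 0\<close>, which says exactly that the Catalan sums times \<open>n\<^sup>2\<close> have differences \<open>S
  n\<close>. Expanding \<open>(k choose i)\<^sup>2\<close> in the binomial coefficients \<open>k choose (i +
  j)\<close> and summing over \<open>k\<close> gives the integrality of the polynomials.

  For the second part, exchange the sums over \<open>k\<close> and \<open>m\<close> and sum \<open>((k - 1) choose (m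
  - 1))\<^sup>2\<close>, with weight \<open>1\<close> or \<open>p - k\<close>, over \<open>k < p\<close>. With weight
  \<open>p - k\<close> the product with \<open>2 * m choose m\<close> is \<open>- p\<close> modulo
  \<open>p\<^sup>2\<close> for every \<open>m\<close> (for small \<open>m\<close> by a moment of a Legendre
  polynomial), so that harmonic sums remain and Wolstenholme's theorem gives the first congruence. With weight
  \<open>1\<close> what remains is \<open>\<Sum>m. (2 * m choose m) / m\<^sup>2\<close> modulo \<open>p\<close>.
  Expanding \<open>t ^ n + t ^ (- n)\<close>, for \<open>t\<close> a primitive sixth root of unity, in powers of
  \<open>t + 1 / t = 1\<close> and summing against \<open>1 / n\<^sup>2\<close> turns this into twice \<open>\<Sum>n.
  (t ^ n + t ^ (- n)) / n\<^sup>2\<close>, hence into \<open>\<Sum>k\<le>p div 3. 1 / k\<^sup>2\<close>, a value of a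
  Bernoulli polynomial.
\<close>

section \<open>Sums of squared binomial coefficients\<close>

text \<open>Vandermonde expands one factor over \<open>(k - m) choose j\<close>; the product with
  \<open>k choose m\<close> regroups as a multinomial coefficient. Afterwards \<open>k\<close>
  occurs in a single binomial coefficient, so that sums over \<open>k\<close> have closed
  forms.\<close>

lemma square_choose_expansion:
  "(k choose m)\<^sup>2 = (\<Sum>j\<le>m. (k choose (m + j)) * ((m + j) choose m) * (m choose j))"
proof (cases "m \<le> k")
  case True
  have "k choose m = (\<Sum>j\<le>m. ((k - m) choose j) * (m choose j))"
    using vandermonde[of "k - m" m m] True
    by (auto simp: binomial_symmetric[symmetric] intro!: sum.cong)
  hence "(k choose m)\<^sup>2 = (\<Sum>j\<le>m. (k choose m) * ((k - m) choose j) * (m choose j))"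
    by (simp add: power2_eq_square sum_distrib_left mult.assoc)
  also have "\<dots> = (\<Sum>j\<le>m. (k choose (m + j)) * ((m + j) choose m) * (m choose j))"
  proof (intro sum.cong refl)
    fix j
    show "(k choose m) * ((k - m) choose j) * (m choose j) =
          (k choose (m + j)) * ((m + j) choose m) * (m choose j)"
    proof (cases "m + j \<le> k")
      case True
      thus ?thesis using choose_mult[of m "m + j" k] by simp
    next
      case False
      thus ?thesis by (auto simp: binomial_eq_0)
    qed
  qed
  finally show ?thesis .
qed (simp add: binomial_eq_0)

lemma sum_choose_lessThan: "(\<Sum>k<n. k choose r) = n choose Suc r"
  by (induction n) (auto simp: binomial_eq_0)

text \<open>The hockey-stick identity applied twice: passing from \<open>n\<close> to
  \<open>Suc n\<close> raises every weight by one and so adds one unweighted sum.\<close>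

lemma sum_weighted_choose_lessThan: "(\<Sum>k<n. (n - 1 - k) * (k choose r)) = n choose (r + 2)"
proof (induction n)
  case (Suc n)
  have "(\<Sum>k<n. (n - k) * (k choose r)) = (\<Sum>k<n. (n - 1 - k) * (k choose r) + (k choose r))"
    by (intro sum.cong refl) (auto simp: less_iff_Suc_add)
  thus ?case using Suc by (simp add: sum.distrib sum_choose_lessThan)
qed (simp add: binomial_eq_0)

lemma sum_square_choose:
  "(\<Sum>k<n. (k choose a)\<^sup>2) =
     (\<Sum>j\<le>a. (n choose (a + j + 1)) * ((a + j) choose a) * (a choose j))"
  unfolding square_choose_expansion
  by (subst sum.swap) (simp add: sum_distrib_right[symmetric] sum_choose_lessThan)

lemma sum_weighted_square_choose:
  "(\<Sum>k<n. (n - 1 - k) * (k choose a)\<^sup>2) =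
     (\<Sum>j\<le>a. (n choose (a + j + 2)) * ((a + j) choose a) * (a choose j))"
  unfolding square_choose_expansion sum_distrib_left
  by (subst sum.swap) 
     (simp only: mult.assoc[symmetric] sum_distrib_right[symmetric] sum_weighted_choose_lessThan)

text \<open>Both sides are the same quotient of factorials. The right side exposes the factor
  \<open>k + j + 1\<close>, which absorption needs in front of \<open>n choose (k + j + 1)\<close>
  to split off \<open>n\<close>.\<close>

lemma central_choose_rearrange:
  assumes "j \<le> k"
  shows "(2 * k + 1) * ((2 * k) choose k) * ((k + j) choose k) * (k choose j) =
         (k + j + 1) * ((2 * k + 1) choose (k - j)) * ((k + j) choose k)\<^sup>2"
proof -
  have 1: "2 * k + 1 - (k - j) = Suc (k + j)" and 2: "2 * k - k = k" using assms by auto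
  have "rat_of_nat ((2 * k + 1) * ((2 * k) choose k) * ((k + j) choose k) * (k choose j)) =
        rat_of_nat ((k + j + 1) * ((2 * k + 1) choose (k - j)) * ((k + j) choose k)\<^sup>2)"
    using assms 
    by (simp add: binomial_fact 1 2 power2_eq_square divide_simps del: of_nat_Suc)
       (simp add: algebra_simps)
  thus ?thesis by (simp only: of_nat_eq_iff)
qed

text \<open>The squares are symmetric under \<open>j\<close> to \<open>k - j\<close>, so the mean
  index is \<open>k / 2\<close>.\<close>

lemma sum_index_square_choose: "2 * (\<Sum>j\<le>k. j * (k choose j)\<^sup>2) = k * ((2 * k) choose k)"
proof -
  have "(\<Sum>j\<le>k. j * (k choose j)\<^sup>2) = (\<Sum>j\<le>k. (k - j) * (k choose j)\<^sup>2)"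
    by (rule sum.reindex_bij_witness[of _ "\<lambda>j. k - j" "\<lambda>j. k - j"])
       (auto simp: binomial_symmetric[symmetric])
  hence "2 * (\<Sum>j\<le>k. j * (k choose j)\<^sup>2) = (\<Sum>j\<le>k. j * (k choose j)\<^sup>2 + (k - j) * (k choose j)\<^sup>2)"
    by (simp add: sum.distrib)
  also have "\<dots> = (\<Sum>j\<le>k. k * (k choose j)\<^sup>2)"
    by (intro sum.cong refl) (simp add: distrib_right[symmetric])
  finally show ?thesis by (simp add: sum_distrib_left[symmetric] choose_square_sum)
qed

text \<open>The summands below are squares of trinomial coefficients, summed over all
  decompositions of \<open>n\<close> into three parts; exchanging two of the parts gives the identity.\<close>

lemma trinomial_square_symmetry:
  "2 * (\<Sum>k\<le>n. (n - k) * (n choose k)\<^sup>2 * ((2 * k) choose k)) =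
   (\<Sum>k\<le>n. k * (n choose k)\<^sup>2 * ((2 * k) choose k))"
proof -
  define f where "f = (\<lambda>k j. j * (n choose k)\<^sup>2 * (k choose j)\<^sup>2)"
  have "(\<Sum>k\<le>n. k * (n choose k)\<^sup>2 * ((2 * k) choose k)) =
        (\<Sum>k\<le>n. (n choose k)\<^sup>2 * (2 * (\<Sum>j\<le>k. j * (k choose j)\<^sup>2)))"
    by (simp add: sum_index_square_choose mult_ac)
  also have "\<dots> = 2 * (\<Sum>k\<le>n. \<Sum>j\<le>k. f k j)"
    by (simp add: sum_distrib_left mult_ac f_def)
  also have "(\<Sum>k\<le>n. \<Sum>j\<le>k. f k j) = (\<Sum>j\<le>n. \<Sum>k=j..n. f k j)"
    unfolding sum.Sigma[OF finite_atMost] sum.Sigma[OF finite_atMost ballI[OF finite_atMost]]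
      sum.Sigma[OF finite_atMost ballI[OF finite_atLeastAtMost]]
    by (rule sum.reindex_bij_witness[of _ "\<lambda>(j, k). (k, j)" "\<lambda>(k, j). (j, k)"]) auto
  also have "\<dots> = (\<Sum>j\<le>n. j * (n choose j)\<^sup>2 * ((2 * (n - j)) choose (n - j)))"
  proof (intro sum.cong refl)
    fix j assume "j \<in> {..n}"
    hence j: "j \<le> n" by simp
    \<comment> \<open>Choosing \<open>k\<close> of \<open>n\<close> and then \<open>j\<close> of
      those amounts to choosing \<open>j\<close> first and then \<open>k - j\<close> of the rest;
      the inner sum is again a sum of squares.\<close>
    have "(\<Sum>k=j..n. f k j) = (\<Sum>k=j..n. j * (n choose j)\<^sup>2 * ((n - j) choose (k - j))\<^sup>2)"
    proof (intro sum.cong refl)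
      fix k assume k: "k \<in> {j..n}"
      have "((n choose k) * (k choose j))\<^sup>2 = ((n choose j) * ((n - j) choose (k - j)))\<^sup>2"
        using k by (simp add: choose_mult)
      thus "f k j = j * (n choose j)\<^sup>2 * ((n - j) choose (k - j))\<^sup>2"
        by (simp add: f_def power_mult_distrib mult.assoc)
    qed
    also have "\<dots> = (\<Sum>i\<le>n - j. j * (n choose j)\<^sup>2 * ((n - j) choose i)\<^sup>2)"
      using j by (intro sum.reindex_bij_witness[of _ "\<lambda>i. i + j" "\<lambda>k. k - j"]) auto
    finally show "(\<Sum>k=j..n. f k j) = j * (n choose j)\<^sup>2 * ((2 * (n - j)) choose (n - j))"
      by (simp add: sum_distrib_left[symmetric] choose_square_sum)
  qed
  also have "\<dots> = (\<Sum>k\<le>n. (n - k) * (n choose k)\<^sup>2 * ((2 * k) choose k))"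
    by (rule sum.reindex_bij_witness[of _ "\<lambda>j. n - j" "\<lambda>j. n - j"])
       (auto simp: binomial_symmetric[symmetric])
  finally show ?thesis by simp
qed

section \<open>Integrality of the polynomial means\<close>

lemma coeff_S_poly:
  "Polynomial.coeff (S_poly n) i = of_nat ((n choose i)\<^sup>2 * ((2 * i) choose i) * (2 * i + 1))"
  by (cases "i \<le> n") (auto simp: S_poly_def coeff_sum sum.delta binomial_eq_0)

text \<open>The free bound \<open>N\<close> makes the range of \<open>k\<close> independent of
  \<open>n\<close>, so that sums over \<open>n\<close> can be exchanged with it.\<close>

lemma S_altdef:
  assumes "n \<le> N"
  shows "S n = (\<Sum>k\<le>N. of_nat ((n choose k)\<^sup>2 * ((2 * k) choose k) * (2 * k + 1)))"
proof -
  have "S n = (\<Sum>k\<le>n. of_nat ((n choose k)\<^sup>2 * ((2 * k) choose k) * (2 * k + 1)))"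
    by (simp add: S_def S_poly_def poly_sum poly_monom atLeast0AtMost)
  also have "\<dots> = (\<Sum>k\<le>N. of_nat ((n choose k)\<^sup>2 * ((2 * k) choose k) * (2 * k + 1)))"
    using assms by (intro sum.mono_neutral_left) (auto simp: binomial_eq_0)
  finally show ?thesis .
qed

lemma int_polysI:
  assumes "\<And>i. Polynomial.coeff q i \<in> \<int>"
  shows "q \<in> int_polys"
proof -
  have "q = map_poly of_int (map_poly floor q)"
    using assms by (intro poly_eqI) (simp add: coeff_map_poly of_int_floor_cancel)
  thus ?thesis unfolding int_polys_def by blast
qed

text \<open>The explicit cofactor of \<open>n\<close>: after the rearrangement,
  \<open>(i + j + 1) * (n choose (i + j + 1))\<close> is absorbed into
  \<open>n * ((n - 1) choose (i + j))\<close>.\<close>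

lemma sum_coeff_S_poly:
  "(\<Sum>k<n. (k choose i)\<^sup>2 * ((2 * i) choose i) * (2 * i + 1)) =
   n * (\<Sum>j\<le>i. ((n - 1) choose (i + j)) * ((2 * i + 1) choose (i - j)) * ((i + j) choose i)\<^sup>2)"
proof -
  have "(\<Sum>k<n. (k choose i)\<^sup>2 * ((2 * i) choose i) * (2 * i + 1)) =
        (\<Sum>j\<le>i. (n choose (i + j + 1)) *
            ((2 * i + 1) * ((2 * i) choose i) * ((i + j) choose i) * (i choose j)))"
    by (simp only: sum_distrib_right[symmetric] sum_square_choose)
       (simp only: sum_distrib_right sum_distrib_left mult_ac)
  also have "\<dots> = (\<Sum>j\<le>i. ((i + j + 1) * (n choose (i + j + 1))) *
            (((2 * i + 1) choose (i - j)) * ((i + j) choose i)\<^sup>2))"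
  proof (intro sum.cong refl)
    fix j assume "j \<in> {..i}"
    hence "j \<le> i" by simp
    from central_choose_rearrange[OF this]
    show "(n choose (i + j + 1)) *
            ((2 * i + 1) * ((2 * i) choose i) * ((i + j) choose i) * (i choose j)) =
          ((i + j + 1) * (n choose (i + j + 1))) *
            (((2 * i + 1) choose (i - j)) * ((i + j) choose i)\<^sup>2)"
      by (simp only: mult_ac)
  qed
  also have "\<dots> = (\<Sum>j\<le>i. (n * ((n - 1) choose (i + j))) *
            (((2 * i + 1) choose (i - j)) * ((i + j) choose i)\<^sup>2))"
    by (intro sum.cong refl) (simp only: binomial_absorption Suc_eq_plus1[symmetric])
  finally show ?thesis by (simp only: sum_distrib_left mult_ac)
qed

lemma sum_S_poly_int_polys:
  assumes "n > 0"
  shows "Polynomial.smult (1 / of_nat n) (\<Sum>k=0..n-1. S_poly k) \<in> int_polys"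
proof (rule int_polysI)
  fix i
  have "{0..n-1} = {..<n}" using assms by auto
  hence "Polynomial.coeff (\<Sum>k=0..n-1. S_poly k) i =
        of_nat (\<Sum>k<n. (k choose i)\<^sup>2 * ((2 * i) choose i) * (2 * i + 1))"
    by (simp add: coeff_sum coeff_S_poly)
  thus "Polynomial.coeff (Polynomial.smult (1 / of_nat n) (\<Sum>k=0..n-1. S_poly k)) i \<in> \<int>"
    using assms
    by (simp only: sum_coeff_S_poly coeff_smult of_nat_mult) (simp del: of_nat_sum of_nat_mult)
qed

section \<open>Means of the values and Catalan numbers\<close>

lemma catalan_in_Ints: "catalan k \<in> \<int>"
proof -
  have "(k + 1) * ((2 * k) choose (k + 1)) = k * ((2 * k) choose k)"
  proof -
    have "2 * k - k = k" by simp
    thus ?thesis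
      using binomial_absorb_comp[of "2 * k" k] binomial_absorption[of k "2 * k"]
      by (simp only: Suc_eq_plus1)
  qed
  hence "(k + 1) * ((2 * k) choose k) = (k + 1) * ((2 * k) choose (k + 1)) + ((2 * k) choose k)"
    by simp
  hence "of_nat ((k + 1) * ((2 * k) choose k)) =
         (of_nat ((k + 1) * ((2 * k) choose (k + 1)) + ((2 * k) choose k)) :: rat)"
    by (simp only:)
  \<comment> \<open>The Catalan number is the central binomial coefficient minus its neighbour; the
    absorption identity above clears the denominator \<open>k + 1\<close>.\<close>
  hence "catalan k = of_int (int ((2 * k) choose k) - int ((2 * k) choose (k + 1)))"
    by (simp add: catalan_def field_simps)
  thus ?thesis by simp
qed

text \<open>Termwise the right side is the summand of \<open>S n\<close> plus
  \<open>2 * (n - k) - k\<close> times \<open>t k\<close>, and the extra terms sum to zero by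
  \<open>trinomial_square_symmetry\<close>.\<close>

lemma square_choose_catalan_step:
  "S n = of_nat (n + 1)^2 * (\<Sum>k\<le>n. of_nat (n choose k)^2 * catalan k) -
         of_nat n^2 * (\<Sum>k\<le>n. of_nat ((n - 1) choose k)^2 * catalan k)"
proof -
  define t :: "nat \<Rightarrow> rat" where "t = (\<lambda>k. of_nat ((n choose k)\<^sup>2 * ((2 * k) choose k)))"
  have "(of_nat (n + 1)^2 * of_nat (n choose k)^2 * catalan k -
          of_nat n^2 * of_nat ((n - 1) choose k)^2 * catalan k) =
        t k * of_nat (2 * k + 1) + (2 * (of_nat (n - k) * t k) - of_nat k * t k)" if k: "k \<le> n" for k
  proof -
    have "of_nat n * of_nat ((n - 1) choose k) = (of_nat (n - k) * of_nat (n choose k) :: rat)"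
      by (simp only: of_nat_mult[symmetric] binomial_absorb_comp)
    hence "of_nat n^2 * of_nat ((n - 1) choose k)^2 = (of_nat (n - k)^2 * of_nat (n choose k)^2 :: rat)"
      by (simp only: power_mult_distrib[symmetric])
    hence "of_nat (n + 1)^2 * of_nat (n choose k)^2 * catalan k -
             of_nat n^2 * of_nat ((n - 1) choose k)^2 * catalan k =
           (of_nat (n + 1)^2 * of_nat (n choose k)^2 - of_nat (n - k)^2 * of_nat (n choose k)^2) * catalan k"
      by (simp only: left_diff_distrib)
    also have "\<dots> = (of_nat (n + 1)^2 - of_nat (n - k)^2) / of_nat (k + 1) * t k"
      by (simp add: t_def catalan_def algebra_simps diff_divide_distrib)
    \<comment> \<open>A difference of squares, whose factor \<open>k + 1\<close> cancels the Catalan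
      denominator.\<close>
    also have "(of_nat (n + 1)^2 - of_nat (n - k)^2 :: rat) =
               of_nat (k + 1) * of_nat (2 * n - k + 1)"
    proof -
      obtain d where "n = k + d" using k by (auto simp: le_iff_add)
      thus ?thesis by (simp add: algebra_simps power2_eq_square)
    qed
    also have "of_nat (k + 1) * of_nat (2 * n - k + 1) / of_nat (k + 1) = (of_nat (2 * n - k + 1) :: rat)"
      by (simp del: of_nat_Suc of_nat_add)
    also have "(of_nat (2 * n - k + 1) :: rat) * t k =
               t k * of_nat (2 * k + 1) + (2 * (of_nat (n - k) * t k) - of_nat k * t k)"
      using k by (simp add: of_nat_diff algebra_simps)
    finally show ?thesis .
  qed
  note * = this
  have "of_nat (n + 1)^2 * (\<Sum>k\<le>n. of_nat (n choose k)^2 * catalan k) -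
         of_nat n^2 * (\<Sum>k\<le>n. of_nat ((n - 1) choose k)^2 * catalan k) =
        (\<Sum>k\<le>n. of_nat (n + 1)^2 * of_nat (n choose k)^2 * catalan k -
          of_nat n^2 * of_nat ((n - 1) choose k)^2 * catalan k)"
    by (simp only: sum_distrib_left sum_subtractf mult.assoc)
  also have "\<dots> = (\<Sum>k\<le>n. t k * of_nat (2 * k + 1) + (2 * (of_nat (n - k) * t k) - of_nat k * t k))"
    by (intro sum.cong refl *) auto
  also have "\<dots> = (\<Sum>k\<le>n. t k * of_nat (2 * k + 1)) +
      (2 * (\<Sum>k\<le>n. of_nat (n - k) * t k) - (\<Sum>k\<le>n. of_nat k * t k))"
    by (simp only: sum.distrib sum_subtractf sum_distrib_left)
  also have "2 * (\<Sum>k\<le>n. of_nat (n - k) * t k) = (\<Sum>k\<le>n. of_nat k * t k)"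
    using arg_cong[OF trinomial_square_symmetry[of n], of rat_of_nat]
    by (simp add: t_def mult.assoc del: of_nat_diff)
  also have "(\<Sum>k\<le>n. t k * of_nat (2 * k + 1)) = S n"
    by (simp only: S_altdef[OF order.refl] t_def of_nat_mult)
  finally show ?thesis by simp
qed

lemma sum_S:
  "(\<Sum>k\<le>n. S k) = of_nat (n + 1)^2 * (\<Sum>k\<le>n. of_nat (n choose k)^2 * catalan k)"
proof (induction n)
  case 0
  show ?case using square_choose_catalan_step[of 0] by simp
next
  case (Suc n)
  thus ?case using square_choose_catalan_step[of "Suc n"]
    by (simp add: binomial_eq_0 del: of_nat_Suc of_nat_add binomial_Suc_Suc)
qed

lemma mean_S_eq_catalan_sum:
  assumes "n > 0"
  shows "1 / (of_nat n)\<^sup>2 * (\<Sum>k=0..n-1. S k) =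
         (\<Sum>k=0..n-1. (of_nat ((n - 1) choose k))\<^sup>2 * catalan k)"
  using sum_S[of "n - 1"] assms by (simp add: atLeast0AtMost)

section \<open>A moment of the Legendre polynomials\<close>

text \<open>Alternating binomial sums are iterated finite differences: Pascal's rule trades one unit
  of order for one difference of \<open>g\<close>. This drives the inductions on \<open>a\<close>
  below.\<close>

lemma alternating_choose_sum_Suc:
  fixes g :: "nat \<Rightarrow> 'a::comm_ring_1"
  shows "(\<Sum>j\<le>Suc a. (-1)^j * of_nat (Suc a choose j) * g j) =
         (\<Sum>j\<le>a. (-1)^j * of_nat (a choose j) * (g j - g (Suc j)))"
proof -
  have "(\<Sum>j\<le>Suc a. (-1)^j * of_nat (Suc a choose j) * g j) =
        g 0 + (\<Sum>j\<le>a. (-1)^Suc j * of_nat (Suc a choose Suc j) * g (Suc j))"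
    by (subst sum.atMost_Suc_shift) simp
  also have "\<dots> = (g 0 + (\<Sum>j\<le>a. (-1)^Suc j * of_nat (a choose Suc j) * g (Suc j))) -
                  (\<Sum>j\<le>a. (-1)^j * of_nat (a choose j) * g (Suc j))"
    by (simp add: sum.distrib[symmetric] sum_subtractf[symmetric] sum_negf[symmetric] algebra_simps)
  also have "g 0 + (\<Sum>j\<le>a. (-1)^Suc j * of_nat (a choose Suc j) * g (Suc j)) =
             (\<Sum>j\<le>Suc a. (-1)^j * of_nat (a choose j) * g j)"
    by (simp add: sum.atMost_Suc_shift del: sum.atMost_Suc)
  also have "\<dots> = (\<Sum>j\<le>a. (-1)^j * of_nat (a choose j) * g j)"
    by (simp add: binomial_eq_0)
  finally show ?thesis by (simp add: sum_subtractf algebra_simps)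
qed

text \<open>The beta integral of \<open>t ^ (x - 1) * (1 - t) ^ a\<close> over the unit interval.
  The induction keeps \<open>x\<close> arbitrary because a difference of reciprocals involves
  \<open>x\<close> and \<open>Suc x\<close>.\<close>

lemma alternating_choose_reciprocal:
  assumes "x > 0"
  shows "(\<Sum>j\<le>a. (-1)^j * of_nat (a choose j) * (1 / of_nat (x + j))) =
         (1 / (of_nat x * of_nat ((x + a) choose a)) :: 'a::field_char_0)"
  using assms
proof (induction a arbitrary: x)
  case (Suc a)
  define c :: 'a where "c = of_nat ((x + a) choose a)"
  have c: "c \<noteq> 0" by (simp add: c_def)
  have nz: "of_nat x \<noteq> (0::'a)" "of_nat a + 1 \<noteq> (0::'a)" "of_nat x + 1 \<noteq> (0::'a)"
     "of_nat x + of_nat a + 1 \<noteq> (0::'a)"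
    using Suc.prems of_nat_neq_0[of a, where ?'a = 'a] of_nat_neq_0[of x, where ?'a = 'a]
      of_nat_neq_0[of "x + a", where ?'a = 'a] by (simp_all add: algebra_simps)
  have "of_nat (Suc a * ((x + Suc a) choose Suc a)) = (of_nat ((x + Suc a) * ((x + a) choose a)) :: 'a)"
    by (simp only: Suc_times_binomial add_Suc_right)
  hence 1: "of_nat ((x + Suc a) choose Suc a) = (of_nat x + of_nat a + 1) * c / (of_nat a + 1)"
    unfolding of_nat_mult c_def[symmetric] using nz
    by (simp add: divide_simps del: binomial_Suc_Suc add_Suc_right) (simp add: algebra_simps)
  have "Suc x * ((Suc x + a) choose a) = (Suc x + a) * ((x + a) choose a)"
    using Suc_times_binomial_add[of x a] Suc_times_binomial[of x "x + a"] 
    by (metis Suc_times_binomial add.commute add_Suc_right add_diff_cancel_left' binomial_symmetric le_add1)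
  hence "of_nat (Suc x * ((Suc x + a) choose a)) = (of_nat ((Suc x + a) * ((x + a) choose a)) :: 'a)"
    by (simp only:)
  hence 2: "of_nat ((Suc x + a) choose a) = (of_nat x + of_nat a + 1) * c / (of_nat x + 1)"
    unfolding of_nat_mult c_def[symmetric] using nz
    by (simp add: divide_simps del: binomial_Suc_Suc add_Suc) (simp add: algebra_simps)
  have "(\<Sum>j\<le>Suc a. (-1)^j * of_nat (Suc a choose j) * (1 / of_nat (x + j))) =
        (\<Sum>j\<le>a. (-1)^j * of_nat (a choose j) * (1 / of_nat (x + j))) -
        (\<Sum>j\<le>a. (-1)^j * of_nat (a choose j) * (1 / of_nat (Suc x + j)) :: 'a)"
    by (subst alternating_choose_sum_Suc) (simp add: sum_subtractf[symmetric] right_diff_distrib)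
  also have "\<dots> = 1 / (of_nat x * c) - 1 / ((of_nat x + 1) * ((of_nat x + of_nat a + 1) * c / (of_nat x + 1)))"
    by (simp only: Suc.IH[OF Suc.prems] Suc.IH[OF zero_less_Suc] 2 c_def[symmetric])
       (simp only: of_nat_Suc add.commute[of 1 "of_nat x :: 'a"])
  also have "\<dots> = 1 / (of_nat x * of_nat ((x + Suc a) choose Suc a))"
    unfolding 1 using nz c by (simp add: divide_simps)
  finally show ?case .
qed simp

text \<open>A difference of order \<open>a\<close> kills a polynomial in \<open>j\<close> of degree
  \<open>d < a\<close>; each difference lowers the lower index by one.\<close>

lemma alternating_choose_choose_eq_0:
  assumes "d < a"
  shows "(\<Sum>j\<le>a. (-1)^j * of_nat (a choose j) * of_nat ((y + j) choose d)) = (0 :: 'a::comm_ring_1)"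
  using assms
proof (induction a arbitrary: d)
  case (Suc a)
  show ?case
  proof (cases d)
    case 0
    thus ?thesis by (subst alternating_choose_sum_Suc) simp
  next
    case d: (Suc d')
    have "(\<Sum>j\<le>a. (-1)^j * of_nat (a choose j) * of_nat ((y + j) choose d')) = (0 :: 'a)"
      using Suc d by simp
    thus ?thesis
      by (subst alternating_choose_sum_Suc) (simp add: d sum_negf)
  qed
qed simp

text \<open>Up to sign this is the moment of order \<open>a + 1\<close> of the shifted Legendre polynomial
  of degree \<open>a\<close>. Expanding the second binomial coefficient in the \<open>(a + j + 2) choose i\<close>
  reduces it to finite differences.\<close>

lemma legendre_moment:
  "(\<Sum>j\<le>a. (-1)^j * of_nat (a choose j) * of_nat ((a + j) choose a) / of_nat (a + j + 2)) =
   ((-1)^a / of_nat ((2 * a + 2) choose (a + 1)) :: rat)"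
proof -
  define e :: "nat \<Rightarrow> rat" where "e = (\<lambda>i. (-1)^(a - i) * of_nat (a - i + 1))"
  define D :: "nat \<Rightarrow> rat" where
    "D = (\<lambda>i. \<Sum>j\<le>a. (-1)^j * of_nat (a choose j) * (of_nat ((a + j + 2) choose i) / of_nat (a + j + 2)))"
  have neg2: "(-2 :: rat) gchoose k = (-1)^k * of_nat (k + 1)" for k
  proof -
    have "(-2 :: rat) gchoose k = (-1)^k * ((of_nat (Suc k)) gchoose k)"
      by (subst gbinomial_negated_upper) (simp add: add.commute)
    also have "(of_nat (Suc k) :: rat) gchoose k = of_nat (Suc k)"
      by (simp only: binomial_gbinomial[symmetric] binomial_Suc_n)
    finally show ?thesis by simp
  qed
  \<comment> \<open>Vandermonde for the upper argument \<open>(a + j + 2) + (-2)\<close>; the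
    coefficients \<open>e i\<close> are the binomial coefficients of \<open>-2\<close>.\<close>
  have exp: "of_nat ((a + j) choose a) = (\<Sum>i\<le>a. e i * of_nat ((a + j + 2) choose i))" for j
  proof -
    have "of_nat ((a + j) choose a) = ((of_nat (a + j + 2) + (-2) :: rat) gchoose a)"
      by (simp add: binomial_gbinomial)
    also have "\<dots> = (\<Sum>i\<le>a. e i * of_nat ((a + j + 2) choose i))"
      by (subst gbinomial_Vandermonde[symmetric])
         (simp add: neg2 binomial_gbinomial e_def atLeast0AtMost mult_ac)
    finally show ?thesis .
  qed
  \<comment> \<open>For a positive lower index the division by \<open>a + j + 2\<close> is absorbed,
    leaving degree \<open>i < a\<close> in \<open>j\<close>, which the difference of order
    \<open>a\<close> kills. Only the reciprocal term \<open>D 0\<close> survives.\<close>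
  have D: "D (Suc i) = 0" if "i < a" for i
  proof -
    have *: "of_nat ((a + j + 2) choose Suc i) / of_nat (a + j + 2) =
          (of_nat (((a + 1) + j) choose i) / of_nat (Suc i) :: rat)" for j
    proof -
      have "of_nat (Suc i * ((a + j + 2) choose Suc i)) = 
              (of_nat ((a + j + 2) * (((a + 1) + j) choose i)) :: rat)"
        by (subst binomial_absorption) simp
      thus ?thesis unfolding of_nat_mult
        by (subst frac_eq_eq) (simp_all only: mult.commute of_nat_eq_0_iff add_eq_0_iff_both_eq_0, auto)
    qed
    have "D (Suc i) = (\<Sum>j\<le>a. (-1)^j * of_nat (a choose j) * of_nat (((a + 1) + j) choose i)) / of_nat (Suc i)"
      unfolding D_def * by (simp add: sum_divide_distrib del: of_nat_Suc of_nat_add)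
    thus ?thesis by (simp only: alternating_choose_choose_eq_0[OF that] div_0)
  qed
  have "(\<Sum>j\<le>a. (-1)^j * of_nat (a choose j) * of_nat ((a + j) choose a) / of_nat (a + j + 2)) =
        (\<Sum>j\<le>a. \<Sum>i\<le>a. e i * ((-1)^j * of_nat (a choose j) *
            (of_nat ((a + j + 2) choose i) / of_nat (a + j + 2))))"
    by (subst exp) (simp add: sum_distrib_left sum_distrib_right sum_divide_distrib mult_ac)
  also have "\<dots> = (\<Sum>i\<le>a. e i * D i)"
    by (subst sum.swap) (simp add: D_def sum_distrib_left)
  also have "\<dots> = e 0 * D 0"
  proof -
    have "D i = 0" if "i \<in> {..a} - {0}" for i
      using D[of "i - 1"] that by (cases i) auto
    thus ?thesis by (subst sum.remove[of _ 0]) auto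
  qed
  also have "D 0 = 1 / (of_nat (a + 2) * of_nat ((a + 2 + a) choose a))"
    unfolding D_def using alternating_choose_reciprocal[of "a + 2" a, where ?'a = rat]
    by (simp add: add_ac)
  also have "e 0 * (1 / (of_nat (a + 2) * of_nat ((a + 2 + a) choose a))) =
             (-1)^a / of_nat ((2 * a + 2) choose (a + 1))"
  proof -
    have "(a + 2) * ((2 * a + 2) choose a) = (a + 1) * ((2 * a + 2) choose (a + 1))"
      using Suc_times_binomial_add[of a "a + 1"]
      by (simp add: mult_2 del: binomial_Suc_Suc mult_Suc)
    hence "of_nat ((a + 2) * ((2 * a + 2) choose a)) = 
            (of_nat ((a + 1) * ((2 * a + 2) choose (a + 1))) :: rat)"
      by (simp only:)
    hence eq: "of_nat (a + 2) * of_nat ((2 * a + 2) choose a) =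
               (of_nat (a + 1) * of_nat ((2 * a + 2) choose (a + 1)) :: rat)"
      by (simp only: of_nat_mult)
    have "a + 2 + a = 2 * a + 2" by simp
    hence "e 0 * (1 / (of_nat (a + 2) * of_nat ((a + 2 + a) choose a))) =
             (-1)^a * of_nat (a + 1) / (of_nat (a + 1) * of_nat ((2 * a + 2) choose (a + 1)))"
      by (simp only: eq e_def) simp
    thus ?thesis
      by (simp del: of_nat_add of_nat_Suc binomial_Suc_Suc)
  qed
  finally show ?thesis .
qed

section \<open>Congruences between rationals\<close>

text \<open>The reduced denominator divides every other one, so any representation with denominator
  prime to \<open>p\<close> suffices; closure under sums and products then needs no reduction of
  fractions.\<close>

lemma local_ints_iff:
  "x \<in> local_ints p \<longleftrightarrow> (\<exists>a b. b \<noteq> 0 \<and> coprime b (int p) \<and> x = of_int a / of_int b)"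
proof
  assume "x \<in> local_ints p"
  moreover obtain a b where "quotient_of x = (a, b)" by force
  ultimately show "\<exists>a b. b \<noteq> 0 \<and> coprime b (int p) \<and> x = of_int a / of_int b"
    using quotient_of_div[of x a b] quotient_of_denom_pos[of x a b]
    by (intro exI[of _ a] exI[of _ b]) (auto simp: local_ints_def)
next
  assume "\<exists>a b. b \<noteq> 0 \<and> coprime b (int p) \<and> x = of_int a / of_int b"
  then obtain a b where ab: "b \<noteq> 0" "coprime b (int p)" "x = of_int a / of_int b" by blast
  obtain n d where nd: "quotient_of x = (n, d)" by force
  have d: "d > 0" "coprime n d" "x = of_int n / of_int d"
    using nd quotient_of_denom_pos quotient_of_coprime quotient_of_div by blast+
  hence "rat_of_int (a * d) = rat_of_int (n * b)"
    using ab by (simp add: field_simps)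
  hence "d dvd n * b" by (simp only: of_int_eq_iff) (metis dvd_triv_right)
  hence "d dvd b" using d(2) by (simp add: coprime_commute coprime_dvd_mult_right_iff)
  hence "coprime d (int p)" using ab(2) by (meson coprime_divisors dvd_refl)
  thus "x \<in> local_ints p" by (simp add: local_ints_def nd)
qed

lemma local_ints_of_int [simp, intro]: "of_int a \<in> local_ints p"
  by (simp add: local_ints_def)

lemma local_ints_of_nat [simp, intro]: "of_nat a \<in> local_ints p"
  by (simp add: local_ints_def)

lemma local_ints_0 [simp, intro]: "0 \<in> local_ints p"
  and local_ints_1 [simp, intro]: "1 \<in> local_ints p"
  and local_ints_numeral [simp, intro]: "numeral n \<in> local_ints p"
  by (simp_all add: local_ints_def)

lemma local_ints_add [simp, intro]:
  assumes "x \<in> local_ints p" "y \<in> local_ints p"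
  shows "x + y \<in> local_ints p"
proof -
  obtain a b c d where *: "b \<noteq> 0" "coprime b (int p)" "x = of_int a / of_int b"
      "d \<noteq> 0" "coprime d (int p)" "y = of_int c / of_int d"
    using assms by (auto simp: local_ints_iff)
  hence "x + y = of_int (a * d + c * b) / of_int (b * d)"
    by (simp add: field_simps)
  thus ?thesis unfolding local_ints_iff using *
    by (intro exI[of _ "a * d + c * b"] exI[of _ "b * d"]) simp
qed

lemma local_ints_mult [simp, intro]:
  assumes "x \<in> local_ints p" "y \<in> local_ints p"
  shows "x * y \<in> local_ints p"
proof -
  obtain a b c d where *: "b \<noteq> 0" "coprime b (int p)" "x = of_int a / of_int b"
      "d \<noteq> 0" "coprime d (int p)" "y = of_int c / of_int d"
    using assms by (auto simp: local_ints_iff)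
  hence "x * y = of_int (a * c) / of_int (b * d)"
    by simp
  thus ?thesis unfolding local_ints_iff using *
    by (intro exI[of _ "a * c"] exI[of _ "b * d"]) simp
qed

lemma local_ints_uminus [simp, intro]: "x \<in> local_ints p \<Longrightarrow> -x \<in> local_ints p"
  using local_ints_mult[OF local_ints_of_int[of "-1"], of x p] by simp

lemma local_ints_diff [simp, intro]:
  "x \<in> local_ints p \<Longrightarrow> y \<in> local_ints p \<Longrightarrow> x - y \<in> local_ints p"
  using local_ints_add[of x p "-y"] by simp

lemma local_ints_power [simp, intro]: "x \<in> local_ints p \<Longrightarrow> x ^ n \<in> local_ints p"
  by (induction n) auto

lemma local_ints_sum [simp, intro]:
  "(\<And>i. i \<in> A \<Longrightarrow> f i \<in> local_ints p) \<Longrightarrow> sum f A \<in> local_ints p"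
  by (induction A rule: infinite_finite_induct) auto

lemma local_ints_prod [simp, intro]:
  "(\<And>i. i \<in> A \<Longrightarrow> f i \<in> local_ints p) \<Longrightarrow> prod f A \<in> local_ints p"
  by (induction A rule: infinite_finite_induct) auto

lemma local_ints_divide_of_nat:
  assumes "x \<in> local_ints p" "coprime n p"
  shows "x / of_nat n \<in> local_ints p"
proof (cases "n = 0")
  case False
  hence "1 / of_nat n \<in> local_ints p"
    unfolding local_ints_iff using assms by (intro exI[of _ 1] exI[of _ "int n"]) auto
  from local_ints_mult[OF assms(1) this] show ?thesis by simp
qed simp

lemma S_local_ints: "S k \<in> local_ints p"
  unfolding S_altdef[OF order.refl] by (intro local_ints_sum local_ints_of_nat)

section \<open>The congruence relation at a prime\<close>

locale local_ring =
  fixes p :: nat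
  assumes prime: "prime p"
begin

text \<open>Unlike in \<open>rat_cong\<close>, the sides need not lie in
  \<open>local_ints p\<close>, which keeps addition and transitivity free of side conditions.
  Membership is supplied at the end by \<open>rat_congI\<close>.\<close>

definition lcong :: "nat \<Rightarrow> rat \<Rightarrow> rat \<Rightarrow> bool" where
  "lcong m a b \<longleftrightarrow> (a - b) / of_nat m \<in> local_ints p"

lemma p_gt_0: "p > 0" and p_gt_1: "p > 1"
  using prime_gt_1_nat[OF prime] by auto

lemma lcong_refl [simp, intro]: "lcong m a a"
  by (simp add: lcong_def)

lemma lcong_sym: "lcong m a b \<Longrightarrow> lcong m b a"
  using local_ints_uminus[of "(a - b) / of_nat m" p]
  by (simp add: lcong_def minus_divide_left del: local_ints_uminus)

lemma lcong_add [intro]: "lcong m a b \<Longrightarrow> lcong m c d \<Longrightarrow> lcong m (a + c) (b + d)"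
  using local_ints_add[of "(a - b) / of_nat m" p "(c - d) / of_nat m"]
  by (simp add: lcong_def add_divide_distrib[symmetric] algebra_simps del: local_ints_add)

lemma lcong_trans [trans]: "lcong m a b \<Longrightarrow> lcong m b c \<Longrightarrow> lcong m a c"
  using local_ints_add[of "(a - b) / of_nat m" p "(b - c) / of_nat m"]
  by (simp add: lcong_def add_divide_distrib[symmetric] del: local_ints_add)

lemma lcong_scale: "lcong m a b \<Longrightarrow> c \<in> local_ints p \<Longrightarrow> lcong m (c * a) (c * b)"
  using local_ints_mult[of c p "(a - b) / of_nat m"]
  by (simp add: lcong_def right_diff_distrib del: local_ints_mult)

lemma lcong_minus [intro]: "lcong m a b \<Longrightarrow> lcong m (- a) (- b)"
  using lcong_scale[of m a b "-1"] by simp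

lemma lcong_diff [intro]: "lcong m a b \<Longrightarrow> lcong m c d \<Longrightarrow> lcong m (a - c) (b - d)"
  using lcong_add[of m a b "-c" "-d"] by auto

lemma lcong_mult:
  assumes "lcong m a b" "lcong m c d" "a \<in> local_ints p" "d \<in> local_ints p"
  shows "lcong m (a * c) (b * d)"
  using lcong_trans[OF lcong_scale[OF assms(2) assms(3)] lcong_scale[OF assms(1) assms(4), unfolded mult.commute[of d]]] .

lemma lcong_local_ints:
  assumes "lcong m a b" "b \<in> local_ints p" "m > 0"
  shows "a \<in> local_ints p"
proof -
  have "of_nat m * ((a - b) / of_nat m) + b \<in> local_ints p"
    using assms unfolding lcong_def by (intro local_ints_add local_ints_mult) auto
  thus ?thesis using assms by simp
qed

lemma lcong_sum [intro]:
  "(\<And>i. i \<in> A \<Longrightarrow> lcong m (f i) (g i)) \<Longrightarrow> lcong m (sum f A) (sum g A)"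
  by (induction A rule: infinite_finite_induct) auto

lemma lcong_prod:
  assumes "\<And>i. i \<in> A \<Longrightarrow> lcong m (f i) (g i)"
    and "\<And>i. i \<in> A \<Longrightarrow> f i \<in> local_ints p" "\<And>i. i \<in> A \<Longrightarrow> g i \<in> local_ints p"
  shows "lcong m (prod f A) (prod g A)"
  using assms by (induction A rule: infinite_finite_induct) (auto intro!: lcong_mult)

lemma lcong_power:
  assumes "lcong m a b" "a \<in> local_ints p" "b \<in> local_ints p"
  shows "lcong m (a ^ n) (b ^ n)"
  using assms by (induction n) (auto intro!: lcong_mult)

lemma lcong_p_scale: "lcong p a b \<Longrightarrow> lcong (p\<^sup>2) (of_nat p * a) (of_nat p * b)"
  using p_gt_0 by (simp add: lcong_def right_diff_distrib[symmetric] power2_eq_square)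

lemma lcong_0_iff: "lcong p a 0 \<longleftrightarrow> (\<exists>c\<in>local_ints p. a = of_nat p * c)"
  using p_gt_0 by (auto simp: lcong_def intro!: bexI[of _ "a / of_nat p"])

lemma lcong_p_square_imp: "lcong (p\<^sup>2) a b \<Longrightarrow> lcong p a b"
  using local_ints_mult[of "of_nat p" p "(a - b) / of_nat (p\<^sup>2)"] p_gt_0
  by (simp add: lcong_def power2_eq_square del: local_ints_mult)

text \<open>A factor divisible by \<open>p\<close> lifts the modulus: the other factor need only be
  known modulo \<open>p\<close>.\<close>

lemma lcong_0_mult:
  assumes "lcong p a 0" "lcong p b c"
  shows "lcong (p\<^sup>2) (a * b) (a * c)"
proof -
  obtain d where d: "d \<in> local_ints p" "a = of_nat p * d"
    using assms(1) by (auto simp: lcong_0_iff)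
  have "lcong (p\<^sup>2) (of_nat p * (d * b)) (of_nat p * (d * c))"
    by (intro lcong_p_scale lcong_scale assms d)
  thus ?thesis by (simp add: d mult.assoc)
qed

lemma lcong_of_nat_dvd: "p dvd n \<Longrightarrow> lcong p (of_nat n) 0"
  by (auto simp: lcong_0_iff elim!: dvdE)

lemma coprime_small: "0 < k \<Longrightarrow> k < p \<Longrightarrow> coprime k p"
  using prime by (metis coprime_commute nat_dvd_not_less prime_imp_coprime)

lemma local_ints_divide_small [intro]:
  "x \<in> local_ints p \<Longrightarrow> k < p \<Longrightarrow> x / of_nat k \<in> local_ints p"
  by (cases "k = 0") (auto intro: local_ints_divide_of_nat coprime_small)

lemma local_ints_divide_small_power [intro]:
  "x \<in> local_ints p \<Longrightarrow> k < p \<Longrightarrow> x / of_nat k ^ n \<in> local_ints p"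
  using local_ints_mult[OF _ local_ints_power[OF local_ints_divide_small[OF local_ints_1, of k]], of x n]
  by (simp add: power_divide)

lemma local_ints_divide_fact: "x \<in> local_ints p \<Longrightarrow> k < p \<Longrightarrow> x / fact k \<in> local_ints p"
  using local_ints_divide_of_nat[of x p "fact k"] prime
  by (simp add: coprime_commute prime_imp_coprime prime_dvd_fact_iff)

lemma lcong_divide_small:
  "lcong m a b \<Longrightarrow> k < p \<Longrightarrow> lcong m (a / of_nat k) (b / of_nat k)"
  using lcong_scale[of m a b "1 / of_nat k"] by (auto simp: local_ints_divide_small)

lemma lcong_cancel:
  assumes "lcong m (c * a) (c * b)" "1 / c \<in> local_ints p" "c \<noteq> 0"
  shows "lcong m a b"
  using lcong_scale[OF assms(1,2)] assms(3) by simp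

lemma lcong_inverse:
  assumes "lcong m a b" "1 / a \<in> local_ints p" "1 / b \<in> local_ints p" "a \<noteq> 0" "b \<noteq> 0"
  shows "lcong m (1 / a) (1 / b)"
proof -
  have "lcong m (1 / a * (1 / b) * b) (1 / a * (1 / b) * a)"
    using assms by (intro lcong_scale lcong_sym[of m a b] local_ints_mult)
  thus ?thesis using assms by simp
qed

lemma lcong_p: "lcong p (of_nat p) 0"
  by (rule lcong_of_nat_dvd) simp

lemma lcong_p_minus: "k \<le> p \<Longrightarrow> lcong p (of_nat (p - k)) (- of_nat k)"
  using lcong_p by (simp add: lcong_def of_nat_diff)

lemma lcong_inverse_p_minus:
  assumes "0 < k" "k < p"
  shows "lcong p (1 / of_nat (p - k)) (- (1 / of_nat k))"
proof -
  have "1 / - of_nat k \<in> local_ints p"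
    using local_ints_uminus[OF local_ints_divide_small[OF local_ints_1 assms(2)]] by simp
  hence "lcong p (1 / of_nat (p - k)) (1 / - of_nat k)"
    using assms by (intro lcong_inverse lcong_p_minus local_ints_divide_small) auto
  thus ?thesis by simp
qed

lemma lcong_inverse_p_minus_square:
  assumes "0 < k" "k < p"
  shows "lcong p (1 / of_nat (p - k)^2) (1 / of_nat k^2)"
proof -
  have "lcong p ((1 / of_nat (p - k))^2) ((- (1 / of_nat k))^2)"
    using assms by (intro lcong_power lcong_inverse_p_minus local_ints_uminus local_ints_divide_small) auto
  thus ?thesis by (simp add: power_divide del: of_nat_diff)
qed

text \<open>For \<open>d < p\<close> the denominator \<open>fact d\<close> is prime to
  \<open>p\<close>, so the upper argument may be reduced like that of any polynomial with
  coefficients in the local ring. Negative upper arguments are allowed.\<close>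

lemma lcong_gbinomial:
  assumes "lcong m x y" "x \<in> local_ints p" "y \<in> local_ints p" "d < p"
  shows "lcong m (x gchoose d) (y gchoose d)"
proof -
  have "lcong m (1 / fact d * (\<Prod>i=0..<d. x - of_nat i)) (1 / fact d * (\<Prod>i=0..<d. y - of_nat i))"
    using assms by (intro lcong_scale lcong_prod) (auto intro!: local_ints_divide_fact)
  thus ?thesis by (simp add: gbinomial_prod_rev)
qed

text \<open>Reduce the upper argument to \<open>- (c + 1)\<close> and negate it.\<close>

lemma choose_p_minus_cong:
  assumes "c < p" "d < p"
  shows "lcong p (of_nat ((p - 1 - c) choose d)) ((-1)^d * of_nat ((c + d) choose d))"
proof -
  have "lcong p (of_nat (p - Suc c)) (- of_nat (Suc c))"
    using assms by (intro lcong_p_minus) auto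
  hence "lcong p (of_nat (p - 1 - c) gchoose d) ((- of_nat (Suc c)) gchoose d)"
    using assms by (intro lcong_gbinomial) (auto simp del: of_nat_Suc)
  also have "(- of_nat (Suc c) gchoose d :: rat) = (-1)^d * (of_nat (c + d) gchoose d)"
    by (subst gbinomial_minus) (simp add: add_ac)
  finally show ?thesis by (simp only: binomial_gbinomial)
qed

lemma choose_p_pred_cong:
  assumes "d < p"
  shows "lcong p (of_nat ((p - 1) choose d)) ((-1)^d)"
  using choose_p_minus_cong[OF p_gt_0 assms] by simp

text \<open>Absorption splits off the factor \<open>p\<close>, so the cofactor
  \<open>(p - 1) choose r\<close> is needed only modulo \<open>p\<close>, where it is
  \<open>(-1) ^ r\<close>.\<close>

lemma choose_p_cong:
  assumes "r + 1 < p"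
  shows "lcong (p\<^sup>2) (of_nat (p choose (r + 1))) ((-1)^r * of_nat p / of_nat (r + 1))"
proof -
  have "of_nat (Suc r * (p choose Suc r)) = (of_nat (p * ((p - 1) choose r)) :: rat)"
    by (simp only: binomial_absorption)
  hence eq: "of_nat (p choose (r + 1)) = of_nat p * (of_nat ((p - 1) choose r) / of_nat (r + 1) :: rat)"
    by (simp add: field_simps del: binomial_Suc_Suc)
  have "lcong (p\<^sup>2) (of_nat p * (of_nat ((p - 1) choose r) / of_nat (r + 1)))
          (of_nat p * ((-1)^r / of_nat (r + 1)))"
    using assms by (intro lcong_p_scale lcong_divide_small choose_p_pred_cong) auto
  thus ?thesis by (simp only: eq mult.commute times_divide_eq_right)
qed

text \<open>The prime divides \<open>fact (2 * m)\<close> but not \<open>fact m\<close>.\<close>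

lemma central_choose_cong_0:
  assumes "p \<le> 2 * m" "m < p"
  shows "lcong p (of_nat ((2 * m) choose m)) 0"
proof (rule lcong_of_nat_dvd)
  have "fact m * fact (2 * m - m) * ((2 * m) choose m) = (fact (2 * m) :: nat)"
    by (rule binomial_fact_lemma) auto
  hence "p dvd fact m * fact m * ((2 * m) choose m)"
    using assms prime by (simp add: prime_dvd_fact_iff)
  thus "p dvd ((2 * m) choose m)"
    using assms prime by (simp add: prime_dvd_mult_iff prime_dvd_fact_iff)
qed

text \<open>A case of Lucas's theorem. By symmetry the lower index becomes \<open>n - p < p\<close>,
  and then the upper argument may be reduced to \<open>n - p\<close> too.\<close>

lemma choose_p_cong_1:
  assumes "p \<le> n" "n < 2 * p"
  shows "lcong p (of_nat (n choose p)) 1"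
proof -
  have "lcong p (of_nat n) (of_nat (n - p))"
    using assms lcong_p by (simp add: lcong_def of_nat_diff)
  hence "lcong p (of_nat n gchoose (n - p)) (of_nat (n - p) gchoose (n - p))"
    using assms by (intro lcong_gbinomial) auto
  hence "lcong p (of_nat (n choose (n - p))) 1"
    by (simp only: binomial_gbinomial[symmetric]) simp
  thus ?thesis using assms by (simp add: binomial_symmetric[of p n])
qed

lemma rat_congI:
  assumes "lcong m a b" "a \<in> local_ints p" "b \<in> local_ints p" "m > 0"
  shows "rat_cong p a b m"
  using assms unfolding rat_cong_def lcong_def by (auto intro!: bexI[of _ "(a - b) / of_nat m"])

end

section \<open>Bernoulli polynomials and sums of inverse squares\<close>

lemma poly_bernoulli_poly:
  "poly (bernoulli_poly n) x = (\<Sum>k\<le>n. of_nat (n choose k) * bernoulli k * x ^ (n - k))"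
  by (simp add: bernoulli_poly_def poly_sum poly_monom)

lemma coeff_bernoulli_poly:
  "Polynomial.coeff (bernoulli_poly n) i = of_nat (n choose i) * bernoulli (n - i)"
proof (cases "i \<le> n")
  case True
  have "Polynomial.coeff (bernoulli_poly n) i =
        (\<Sum>k\<le>n. if k = n - i then of_nat (n choose k) * bernoulli k else 0)"
    unfolding bernoulli_poly_def coeff_sum using True by (intro sum.cong) auto
  also have "\<dots> = of_nat (n choose i) * bernoulli (n - i)"
    using True by (simp add: binomial_symmetric[symmetric])
  finally show ?thesis .
next
  case False
  thus ?thesis by (auto simp: bernoulli_poly_def coeff_sum binomial_eq_0 intro!: sum.neutral)
qed

lemma bernoulli_recurrence:
  assumes "m > 0"
  shows "(\<Sum>k\<le>m. of_nat (Suc m choose k) * bernoulli k) = 0"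
proof -
  obtain n where n: "m = Suc n" using assms gr0_implies_Suc by blast
  have "of_nat (n + 2) * bernoulli (Suc n) = - (\<Sum>k\<le>n. of_nat ((n + 2) choose k) * bernoulli k)"
    unfolding bernoulli.simps(2) by (simp del: of_nat_add)
  moreover have "(n + 2) choose Suc n = n + 2"
    using binomial_Suc_n[of "Suc n"] by simp
  ultimately show ?thesis by (simp add: n del: binomial_Suc_Suc of_nat_Suc of_nat_add binomial_Suc_n)
qed

lemma poly_bernoulli_poly_0: "poly (bernoulli_poly n) 0 = bernoulli n"
  using coeff_bernoulli_poly[of n 0] by (simp add: poly_0_coeff_0)

lemma poly_bernoulli_poly_1:
  "poly (bernoulli_poly n) 1 = bernoulli n + (if n = 1 then 1 else 0)"
proof (cases "n \<ge> 2")
  case True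
  then obtain m where "n = Suc m" "m > 0" by (cases n) auto
  thus ?thesis using bernoulli_recurrence[of m] by (simp add: poly_bernoulli_poly)
next
  case False
  hence "n = 0 \<or> n = 1" by auto
  thus ?thesis by (auto simp: poly_bernoulli_poly)
qed

text \<open>The addition formula of an Appell sequence: expand \<open>(x + y) ^ (n - i)\<close> and
  collect the pairs \<open>(i, j)\<close> by \<open>k = i + j\<close>.\<close>

lemma poly_bernoulli_poly_add:
  "poly (bernoulli_poly n) (x + y) =
   (\<Sum>k\<le>n. of_nat (n choose k) * poly (bernoulli_poly k) x * y ^ (n - k))"
proof -
  have "poly (bernoulli_poly n) (x + y) =
        (\<Sum>i\<le>n. \<Sum>j\<le>n-i. of_nat (n choose i) * bernoulli i *
            (of_nat ((n - i) choose j) * x ^ j * y ^ (n - i - j)))"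
    by (simp add: poly_bernoulli_poly binomial_ring sum_distrib_left)
  also have "\<dots> = (\<Sum>k\<le>n. \<Sum>i\<le>k. of_nat (n choose k) *
                    (of_nat (k choose i) * bernoulli i * x ^ (k - i)) * y ^ (n - k))"
    unfolding sum.Sigma[OF finite_atMost ballI[OF finite_atMost]]
  proof (rule sum.reindex_bij_witness[of _ "\<lambda>(k, i). (i, k - i)" "\<lambda>(i, j). (i + j, i)"], goal_cases)
    case (5 a)
    obtain i j where a: "a = (i, j)" by force
    with 5 have "i + j \<le> n" by auto
    hence "(n choose (i + j)) * ((i + j) choose i) = (n choose i) * ((n - i) choose j)"
      using choose_mult[of i "i + j" n] by simp
    hence "of_nat (n choose (i + j)) * of_nat ((i + j) choose i) =
           (of_nat (n choose i) * of_nat ((n - i) choose j) :: rat)"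
      by (simp only: of_nat_mult[symmetric])
    thus ?case by (simp add: a mult_ac)
  qed auto
  also have "\<dots> = (\<Sum>k\<le>n. of_nat (n choose k) * poly (bernoulli_poly k) x * y ^ (n - k))"
    by (simp add: poly_bernoulli_poly sum_distrib_left sum_distrib_right)
  finally show ?thesis .
qed

text \<open>The addition formula at base point \<open>1\<close>: the values there are the Bernoulli
  numbers except at index \<open>1\<close>, whose excess of \<open>1\<close> gives the extra
  term.\<close>

lemma poly_bernoulli_poly_shift:
  "poly (bernoulli_poly n) (1 + x) = poly (bernoulli_poly n) x + of_nat n * x ^ (n - 1)"
proof -
  have "poly (bernoulli_poly n) (1 + x) =
        (\<Sum>k\<le>n. of_nat (n choose k) * bernoulli k * x ^ (n - k) +
           (if k = 1 then of_nat n * x ^ (n - 1) else 0))"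
    by (subst poly_bernoulli_poly_add, intro sum.cong refl)
       (auto simp: poly_bernoulli_poly_1 algebra_simps)
  also have "\<dots> = poly (bernoulli_poly n) x + of_nat n * x ^ (n - 1)"
    by (cases n) (auto simp: sum.distrib poly_bernoulli_poly)
  finally show ?thesis .
qed

lemma sum_powers_bernoulli_poly:
  "of_nat n * (\<Sum>k<N. of_nat k ^ (n - 1)) = poly (bernoulli_poly n) (of_nat N) - bernoulli n"
proof (induction N)
  case (Suc N)
  thus ?case by (simp add: poly_bernoulli_poly_shift algebra_simps)
qed (simp add: poly_bernoulli_poly_0)

lemma pderiv_bernoulli_poly:
  "pderiv (bernoulli_poly (Suc n)) = Polynomial.smult (of_nat (Suc n)) (bernoulli_poly n)"
proof (rule poly_eqI)
  fix i
  have "of_nat (Suc i * (Suc n choose Suc i)) = (of_nat (Suc n * (n choose i)) :: rat)"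
    by (simp only: Suc_times_binomial)
  hence "of_nat (Suc i) * of_nat (Suc n choose Suc i) = (of_nat (Suc n) * of_nat (n choose i) :: rat)"
    by (simp only: of_nat_mult)
  thus "Polynomial.coeff (pderiv (bernoulli_poly (Suc n))) i =
        Polynomial.coeff (Polynomial.smult (of_nat (Suc n)) (bernoulli_poly n)) i"
    by (simp add: coeff_pderiv coeff_bernoulli_poly mult.assoc[symmetric] del: binomial_Suc_Suc of_nat_Suc)
qed

text \<open>By periodicity the value at \<open>0\<close> is taken at every natural number, that is,
  infinitely often.\<close>

lemma periodic_poly_const:
  fixes q :: "'a::field_char_0 poly"
  assumes "\<And>x. poly q (1 + x) = poly q x"
  shows "q = [:poly q 0:]"
proof -
  have "poly q (of_nat n) = poly q 0" for n
    using assms by (induction n) auto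
  hence "range of_nat \<subseteq> {x. poly (q - [:poly q 0:]) x = 0}" by auto
  moreover have "infinite (range (of_nat :: nat \<Rightarrow> 'a))"
    by (rule range_inj_infinite) (simp add: inj_of_nat)
  ultimately have "infinite {x. poly (q - [:poly q 0:]) x = 0}"
    using finite_subset by blast
  hence "q - [:poly q 0:] = 0" using poly_roots_finite by blast
  thus ?thesis by simp
qed

text \<open>Both sides have the same difference, hence differ by a constant; since the family is
  an Appell sequence, that constant is a multiple of the derivative of the next difference,
  which is again constant.\<close>

lemma bernoulli_poly_reflect:
  "poly (bernoulli_poly n) (1 - x) = (-1)^n * poly (bernoulli_poly n) x"
proof -
  define D where "D = (\<lambda>n. Polynomial.smult ((-1)^n) (pcompose (bernoulli_poly n) [:1, -1:]) - bernoulli_poly n)"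
  have polyD: "poly (D n) x = (-1)^n * poly (bernoulli_poly n) (1 - x) - poly (bernoulli_poly n) x" for n x
    by (simp add: D_def poly_pcompose)
  have "poly (D n) (1 + x) = poly (D n) x" for n x
  proof -
    have "poly (bernoulli_poly n) (1 - x) = poly (bernoulli_poly n) (- x) + of_nat n * (-x) ^ (n - 1)"
      using poly_bernoulli_poly_shift[of n "-x"] by simp
    thus ?thesis
      by (cases n) (auto simp: polyD poly_bernoulli_poly_shift power_minus[of x] algebra_simps)
  qed
  hence const: "D n = [:poly (D n) 0:]" for n by (rule periodic_poly_const)
  have "pderiv (D (Suc n)) = Polynomial.smult (of_nat (Suc n)) (D n)"
    by (simp add: D_def pderiv_diff pderiv_smult pderiv_minus pderiv_pcompose pderiv_bernoulli_poly pderiv_pCons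
          pcompose_smult smult_diff_right mult.commute del: of_nat_Suc)
  moreover have "pderiv (D (Suc n)) = 0"
    by (subst const) (simp add: pderiv_pCons)
  ultimately have "D n = 0" by (simp del: of_nat_Suc)
  hence "poly (bernoulli_poly n) x = (-1)^n * poly (bernoulli_poly n) (1 - x)"
    using polyD[of n x] by simp
  thus ?thesis by (simp flip: mult.assoc power_add)
qed

text \<open>Reflection at \<open>0\<close> compares the values at \<open>1\<close> and
  \<open>0\<close>, which coincide for \<open>n\<close> other than \<open>1\<close>.\<close>

lemma bernoulli_odd_eq_0:
  assumes "odd n" "n \<noteq> 1"
  shows "bernoulli n = 0"
  using bernoulli_poly_reflect[of n 0] assms
  by (simp add: poly_bernoulli_poly_0 poly_bernoulli_poly_1)

lemma Legendre_3:
  assumes "p mod 3 \<noteq> 0"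
  shows "Legendre (int p) 3 = (if p mod 3 = 1 then 1 else -1)"
proof -
  have n0: "\<not> [int p = 0] (mod 3)"
    using assms by (simp add: cong_def) presburger
  have "QuadRes 3 (int p) \<longleftrightarrow> p mod 3 = 1"
  proof
    assume "QuadRes 3 (int p)"
    then obtain y where "y\<^sup>2 mod 3 = int p mod 3" by (auto simp: QuadRes_def cong_def)
    moreover have "y\<^sup>2 mod 3 \<in> {0, 1}"
    proof -
      have "y mod 3 = 0 \<or> y mod 3 = 1 \<or> y mod 3 = 2" by presburger
      moreover have "y\<^sup>2 mod 3 = (y mod 3)\<^sup>2 mod 3" by (simp add: power_mod)
      ultimately show ?thesis by auto
    qed
    ultimately have "int p mod 3 \<in> {0, 1}" by simp
    thus "p mod 3 = 1" using assms by auto presburger+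
  next
    assume "p mod 3 = 1"
    hence "[1\<^sup>2 = int p] (mod 3)" unfolding cong_def by simp presburger
    thus "QuadRes 3 (int p)" unfolding QuadRes_def by blast
  qed
  thus ?thesis using n0 by (simp add: Legendre_def)
qed

text \<open>The recurrence at index \<open>n\<close> divides only by \<open>n + 1 < p\<close>, so no
  denominator acquires the factor \<open>p\<close>.\<close>

lemma bernoulli_local_ints:
  assumes "prime p" "n + 1 < p"
  shows "bernoulli n \<in> local_ints p"
  using assms(2)
proof (induction n rule: less_induct)
  case (less n)
  interpret local_ring p by standard fact
  show ?case
  proof (cases n)
    case (Suc m)
    have "- (\<Sum>k\<le>m. of_nat ((m + 2) choose k) * bernoulli k) / of_nat (m + 2) \<in> local_ints p"
      using less by (intro local_ints_divide_small local_ints_uminus local_ints_sum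
           local_ints_mult local_ints_of_nat less.IH) (auto simp: Suc)
    thus ?thesis by (simp add: Suc bernoulli.simps(2))
  qed simp
qed

section \<open>Harmonic numbers of order two modulo p\<close>

definition H2 :: "nat \<Rightarrow> rat" where
  "H2 N = (\<Sum>k=1..N. 1 / of_nat k ^ 2)"

locale local_ring_gt_3 = local_ring +
  assumes p_gt_3: "p > 3"
begin

lemma odd_p: "odd p"
  using prime p_gt_3 by (simp add: prime_odd_nat)

lemma p_mod_3: "p mod 3 \<noteq> 0"
  using prime p_gt_3 by (metis dvd_eq_mod_eq_0 less_irrefl one_eq_numeral_iff prime_nat_iff semiring_norm(84))

lemma lcong_poly:
  assumes "lcong m x y" "x \<in> local_ints p" "y \<in> local_ints p" "\<And>i. Polynomial.coeff q i \<in> local_ints p"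
  shows "lcong m (poly q x) (poly q y)"
  unfolding poly_altdef using assms by (intro lcong_sum lcong_scale lcong_power)

lemma lcong_bernoulli_poly:
  assumes "lcong p x y" "x \<in> local_ints p" "y \<in> local_ints p"
  shows "lcong p (poly (bernoulli_poly (p - 2)) x) (poly (bernoulli_poly (p - 2)) y)"
  using assms p_gt_3 prime
  by (intro lcong_poly) (auto simp: coeff_bernoulli_poly intro!: bernoulli_local_ints)

text \<open>Fermat's little theorem divided by \<open>k ^ 2\<close>. It turns inverse squares into
  powers, which Bernoulli polynomials sum.\<close>

lemma inverse_square_cong:
  assumes "0 < k" "k < p"
  shows "lcong p (1 / of_nat k ^ 2) (of_nat k ^ (p - 3))"
proof -
  have "\<not> p dvd k" using assms by (auto dest: dvd_imp_le)
  hence "[k ^ (p - 1) = 1] (mod p)" using prime by (intro fermat_theorem)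
  then obtain m where "k ^ (p - 1) = 1 + m * p"
    using p_gt_1 cong_to_1'_nat[of "k ^ (p - 1)" p] by auto
  hence "lcong p (of_nat (k ^ (p - 1))) 1"
    using p_gt_0 by (simp only: lcong_def) simp
  moreover have "k ^ (p - 1) = k ^ 2 * k ^ (p - 3)"
  proof -
    have "p - 1 = 2 + (p - 3)" using p_gt_3 by simp
    thus ?thesis by (simp only: power_add)
  qed
  ultimately have "lcong p (1 / of_nat k ^ 2 * (of_nat k ^ 2 * of_nat k ^ (p - 3))) (1 / of_nat k ^ 2 * 1)"
    using assms by (intro lcong_scale local_ints_divide_small_power) (simp_all only: of_nat_mult of_nat_power local_ints_1)
  thus ?thesis using assms by (auto intro: lcong_sym)
qed

lemma local_ints_divide_numeral:
  "x \<in> local_ints p \<Longrightarrow> numeral k < p \<Longrightarrow> x / numeral k \<in> local_ints p"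
  using local_ints_divide_small[of x "numeral k"] by simp

lemma bernoulli_p_minus_2: "bernoulli (p - 2) = 0"
  using odd_p p_gt_3 by (intro bernoulli_odd_eq_0) auto

text \<open>The power sum formula for exponent \<open>p - 3\<close>: the Bernoulli number
  \<open>bernoulli (p - 2)\<close> vanishes, its index being odd and above \<open>1\<close>, and
  \<open>1 / (p - 2)\<close> is \<open>- 1 / 2\<close> modulo \<open>p\<close>.\<close>

lemma H2_cong_bernoulli_poly:
  assumes "N < p"
  shows "lcong p (H2 N) (- (1 / 2) * poly (bernoulli_poly (p - 2)) (of_nat (N + 1)))"
proof -
  have "lcong p (H2 N) (\<Sum>k=1..N. of_nat k ^ (p - 3))"
    unfolding H2_def using assms by (intro lcong_sum inverse_square_cong) auto
  \<comment> \<open>The added term \<open>k = 0\<close> vanishes because the exponent is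
    positive.\<close>
  also have "(\<Sum>k=1..N. of_nat k ^ (p - 3)) = (\<Sum>k<N+1. rat_of_nat k ^ (p - 3))"
    using p_gt_3 by (intro sum.mono_neutral_left) auto
  also have "\<dots> = 1 / of_nat (p - 2) * poly (bernoulli_poly (p - 2)) (of_nat (N + 1))"
    using sum_powers_bernoulli_poly[of "p - 2" "N + 1"] p_gt_3
    by (simp add: bernoulli_p_minus_2 field_simps numeral_3_eq_3 del: of_nat_Suc of_nat_diff)
  also have "lcong p \<dots> (- (1 / of_nat 2) * poly (bernoulli_poly (p - 2)) (of_nat (N + 1)))"
  proof (rule lcong_mult)
    show "poly (bernoulli_poly (p - 2)) (of_nat (N + 1)) \<in> local_ints p"
      using prime p_gt_3 unfolding poly_bernoulli_poly
      by (intro local_ints_sum local_ints_mult local_ints_power local_ints_of_nat bernoulli_local_ints) auto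
  qed (use p_gt_3 in \<open>auto intro!: lcong_inverse_p_minus local_ints_divide_small simp del: of_nat_diff of_nat_numeral\<close>)
  finally show ?thesis by simp
qed

lemma H2_p_pred: "lcong p (H2 (p - 1)) 0"
proof -
  have "lcong p (H2 (p - 1)) (- (1 / 2) * poly (bernoulli_poly (p - 2)) (of_nat (p - 1 + 1)))"
    using p_gt_0 by (intro H2_cong_bernoulli_poly) auto
  also have "p - 1 + 1 = p" using p_gt_0 by simp
  also have "lcong p (- (1 / 2) * poly (bernoulli_poly (p - 2)) (of_nat p))
               (- (1 / 2) * poly (bernoulli_poly (p - 2)) 0)"
    using p_gt_3 by (intro lcong_scale lcong_bernoulli_poly lcong_p) (auto intro!: local_ints_uminus local_ints_divide_numeral)
  finally show ?thesis by (simp add: poly_bernoulli_poly_0 bernoulli_p_minus_2)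
qed

text \<open>With \<open>r = p mod 3\<close>, the argument \<open>p div 3 + 1\<close> reduces to
  \<open>1 - r / 3\<close>, which is \<open>2 / 3\<close> or \<open>1 / 3\<close>. Reflection, at
  odd degree, turns the former into the latter with a sign, and this sign is the Legendre
  symbol.\<close>

lemma H2_third:
  "lcong p (H2 (p div 3)) (1 / 2 * of_int (Legendre (int p) 3) * poly (bernoulli_poly (p - 2)) (1 / 3))"
proof -
  define B where "B = poly (bernoulli_poly (p - 2))"
  define r where "r = p mod 3"
  have r: "r = 1 \<or> r = 2" using p_mod_3 unfolding r_def by presburger
  have x: "1 - of_nat r / 3 \<in> local_ints p"
    using p_gt_3 by (intro local_ints_diff local_ints_divide_numeral) auto
  have "p = 3 * (p div 3) + r" by (simp add: r_def)
  hence "of_nat p = (3 * of_nat (p div 3) + of_nat r :: rat)"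
    by (metis of_nat_add of_nat_mult of_nat_numeral)
  hence "of_nat (p div 3 + 1) - (1 - of_nat r / 3) = of_nat p * (1 / 3 :: rat)"
    by simp
  hence "(of_nat (p div 3 + 1) - (1 - of_nat r / 3)) / of_nat p = (1 / 3 :: rat)"
    using p_gt_0 by (simp only:) simp
  hence c: "lcong p (of_nat (p div 3 + 1)) (1 - of_nat r / 3)"
    unfolding lcong_def using p_gt_3 by (simp only:) (auto intro!: local_ints_divide_numeral)
  have "lcong p (H2 (p div 3)) (- (1 / 2) * B (of_nat (p div 3 + 1)))"
    unfolding B_def using p_gt_0 by (intro H2_cong_bernoulli_poly) auto
  also have "lcong p \<dots> (- (1 / 2) * B (1 - of_nat r / 3))"
    unfolding B_def using p_gt_3 x c
    by (intro lcong_scale lcong_bernoulli_poly) (auto intro!: local_ints_uminus local_ints_divide_numeral)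
  also have "- (1 / 2) * B (1 - of_nat r / 3) = 1 / 2 * of_int (Legendre (int p) 3) * B (1 / 3)"
    using r
  proof
    assume "r = 2"
    thus ?thesis using Legendre_3[OF p_mod_3] by (simp add: r_def)
  next
    assume "r = 1"
    moreover have "B (1 - 1 / 3) = - B (1 / 3)"
      unfolding B_def using odd_p p_gt_3 by (subst bernoulli_poly_reflect) simp
    ultimately show ?thesis using Legendre_3[OF p_mod_3] by (simp add: r_def)
  qed
  finally show ?thesis unfolding B_def .
qed

end

section \<open>Central binomial coefficients\<close>

text \<open>The values of \<open>2 * cos (n * pi / 3)\<close>.\<close>

definition hexagonal :: "nat \<Rightarrow> rat" where
  "hexagonal n = (-1)^n * (if 3 dvd n then 2 else -1)"

text \<open>A primitive sixth root of unity satisfies \<open>t ^ 2 = t - 1\<close>.\<close>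

lemma hexagonal_rec: "hexagonal (n + 2) = hexagonal (n + 1) - hexagonal n"
proof -
  have "(3 dvd n \<and> \<not> 3 dvd (n + 1) \<and> \<not> 3 dvd (n + 2)) \<or>
        (\<not> 3 dvd n \<and> 3 dvd (n + 1) \<and> \<not> 3 dvd (n + 2)) \<or>
        (\<not> 3 dvd n \<and> \<not> 3 dvd (n + 1) \<and> 3 dvd (n + 2))"
    by presburger
  thus ?thesis by (elim disjE) (simp_all add: hexagonal_def)
qed

text \<open>The Chebyshev polynomial of the second kind of degree \<open>n\<close> at
  \<open>1 / 2\<close>; terms with \<open>2 * b > n\<close> vanish.\<close>

definition alt_diagonal :: "nat \<Rightarrow> rat" where
  "alt_diagonal n = (\<Sum>b\<le>n. (-1)^b * of_nat ((n - b) choose b))"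

lemma alt_diagonal_rec: "alt_diagonal (n + 2) = alt_diagonal (n + 1) - alt_diagonal n"
proof -
  have "alt_diagonal (n + 2) = 1 + (\<Sum>b\<le>n. (-1)^Suc b * of_nat ((n + 1 - b) choose Suc b))"
    unfolding alt_diagonal_def add_2_eq_Suc' by (subst sum.atMost_Suc_shift) simp
  also have "(\<Sum>b\<le>n. (-1)^Suc b * of_nat ((n + 1 - b) choose Suc b)) =
             (\<Sum>b\<le>n. (-1)^Suc b * of_nat ((n - b) choose Suc b) - (-1)^b * rat_of_nat ((n - b) choose b))"
    by (intro sum.cong refl) (simp add: Suc_diff_le algebra_simps)
  also have "\<dots> = (\<Sum>b\<le>n. (-1)^Suc b * of_nat ((n - b) choose Suc b)) - alt_diagonal n"
    by (simp add: sum_subtractf alt_diagonal_def)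
  also have "1 + ((\<Sum>b\<le>n. (-1)^Suc b * of_nat ((n - b) choose Suc b)) - alt_diagonal n) =
             alt_diagonal (n + 1) - alt_diagonal n"
    unfolding alt_diagonal_def Suc_eq_plus1[symmetric] by (subst sum.atMost_Suc_shift) simp
  finally show ?thesis .
qed

text \<open>The Chebyshev relation \<open>U (n + 2) - U n = 2 * T (n + 2)\<close> at
  \<open>1 / 2\<close>. Both sides obey the same recurrence of order two, so two initial values
  decide.\<close>

lemma alt_diagonal_diff: "alt_diagonal (n + 2) - alt_diagonal n = hexagonal (n + 2)"
proof (induction n rule: induct_nat_012)
  case 0
  have "\<not> 3 dvd Suc (Suc 0)" by presburger
  thus ?case using alt_diagonal_rec[of 0] by (simp add: alt_diagonal_def hexagonal_def)
next
  case 1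
  show ?case using alt_diagonal_rec[of 0] alt_diagonal_rec[of 1]
    by (simp add: alt_diagonal_def hexagonal_def numeral_3_eq_3)
next
  case (ge2 n)
  have "hexagonal (n + 4) = hexagonal (n + 3) - hexagonal (n + 2)"
    using hexagonal_rec[of "n + 2"] by (simp add: eval_nat_numeral)
  thus ?case using ge2 alt_diagonal_rec[of n] alt_diagonal_rec[of "n + 2"]
    by (simp add: eval_nat_numeral)
qed

text \<open>The expansion of \<open>t ^ n + t ^ (- n)\<close> in powers of \<open>t + 1 / t\<close> at a primitive sixth root of
  unity \<open>t\<close>, where \<open>t + 1 / t = 1\<close>.\<close>

lemma hexagonal_expansion:
  assumes "n > 0"
  shows "hexagonal n =
         1 + of_nat n * (\<Sum>b=1..n div 2. (-1)^b / of_nat b * of_nat ((n - b - 1) choose (b - 1)))"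
proof (cases "n = 1")
  case False
  then obtain m where n: "n = m + 2" using assms by (metis One_nat_def Suc_eq_plus1 add_2_eq_Suc' not0_implies_Suc not_gr0)
  have 1: "alt_diagonal n = 1 + (\<Sum>b=1..n div 2. (-1)^b * of_nat ((n - b) choose b))"
  proof -
    have "alt_diagonal n = (\<Sum>b\<in>insert 0 {1..n div 2}. (-1)^b * of_nat ((n - b) choose b))"
      unfolding alt_diagonal_def by (intro sum.mono_neutral_right) (auto simp: binomial_eq_0)
    thus ?thesis by simp
  qed
  have "alt_diagonal m = (\<Sum>b<n div 2. (-1)^b * of_nat ((m - b) choose b))"
    unfolding alt_diagonal_def by (intro sum.mono_neutral_right) (auto simp: n binomial_eq_0)
  also have "\<dots> = (\<Sum>b=1..n div 2. - ((-1)^b * of_nat ((n - b - 1) choose (b - 1))))"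
    by (rule sum.reindex_bij_witness[of _ "\<lambda>b. b - 1" Suc]) (auto simp: n)
  finally have 2: "alt_diagonal m = - (\<Sum>b=1..n div 2. (-1)^b * of_nat ((n - b - 1) choose (b - 1)))"
    by (simp add: sum_negf)
  have "hexagonal n = alt_diagonal n - alt_diagonal m"
    using alt_diagonal_diff[of m] by (simp add: n)
  also have "\<dots> = 1 + (\<Sum>b=1..n div 2. (-1)^b * (of_nat ((n - b) choose b) + of_nat ((n - b - 1) choose (b - 1))))"
    unfolding 1 2 by (simp add: sum.distrib distrib_left)
  also have "(\<Sum>b=1..n div 2. (-1)^b * (of_nat ((n - b) choose b) + of_nat ((n - b - 1) choose (b - 1)))) =
             (\<Sum>b=1..n div 2. of_nat n * ((-1)^b / of_nat b * rat_of_nat ((n - b - 1) choose (b - 1))))"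
  proof (intro sum.cong refl)
    fix b assume b: "b \<in> {1..n div 2}"
    hence bn: "b \<le> n" using div_le_dividend[of n 2] by auto
    \<comment> \<open>By absorption the two binomial coefficients have ratio
      \<open>(n - b) / b\<close>, so their sum is \<open>n / b\<close> times the second.\<close>
    have "of_nat (b * ((n - b) choose b)) = (of_nat ((n - b) * ((n - b - 1) choose (b - 1))) :: rat)"
      using b by (subst times_binomial_minus1_eq) auto
    hence "of_nat ((n - b) choose b) = (of_nat n - of_nat b) / of_nat b * (rat_of_nat ((n - b - 1) choose (b - 1)))"
      using b bn by (simp add: field_simps of_nat_diff)
    hence "of_nat ((n - b) choose b) + rat_of_nat ((n - b - 1) choose (b - 1)) =
           of_nat n / of_nat b * of_nat ((n - b - 1) choose (b - 1))"
      using b by (simp add: field_simps)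
    thus "(-1)^b * (of_nat ((n - b) choose b) + of_nat ((n - b - 1) choose (b - 1))) =
          of_nat n * ((-1)^b / of_nat b * rat_of_nat ((n - b - 1) choose (b - 1)))"
      by (simp only:) simp
  qed
  finally show ?thesis by (simp add: sum_distrib_left)
qed (simp add: hexagonal_def)

section \<open>Auxiliary summation identities\<close>

lemma sum_split_parity:
  fixes f :: "nat \<Rightarrow> 'a::ab_group_add"
  shows "(\<Sum>k=1..N. f k) = (\<Sum>j=1..N div 2. f (2 * j)) + (\<Sum>k\<in>{k\<in>{1..N}. odd k}. f k)"
proof -
  have "(\<Sum>k=1..N. f k) = sum f ({k\<in>{1..N}. even k} \<union> {k\<in>{1..N}. odd k})"
    by (rule arg_cong[of _ _ "sum f"]) auto
  also have "\<dots> = sum f {k\<in>{1..N}. even k} + sum f {k\<in>{1..N}. odd k}"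
    by (intro sum.union_disjoint) auto
  also have "sum f {k\<in>{1..N}. even k} = (\<Sum>j=1..N div 2. f (2 * j))"
    by (rule sum.reindex_bij_witness[of _ "\<lambda>j. 2 * j" "\<lambda>k. k div 2"]) auto
  finally show ?thesis .
qed

lemma sum_multiples_of_3:
  fixes f :: "nat \<Rightarrow> 'a::comm_monoid_add"
  shows "(\<Sum>k=1..N. if 3 dvd k then f k else 0) = (\<Sum>j=1..N div 3. f (3 * j))"
proof -
  have "(\<Sum>k=1..N. if 3 dvd k then f k else 0) = sum f {k\<in>{1..N}. 3 dvd k}"
    by (rule sum.inter_filter[symmetric]) simp
  also have "\<dots> = (\<Sum>j=1..N div 3. f (3 * j))"
    by (rule sum.reindex_bij_witness[of _ "\<lambda>j. 3 * j" "\<lambda>k. k div 3"]) auto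
  finally show ?thesis .
qed

text \<open>Adding \<open>H2 N\<close> kills the odd terms and doubles the even ones.\<close>

lemma alternating_inverse_squares:
  "(\<Sum>k=1..N. (-1)^k / of_nat k ^ 2) = 1 / 2 * H2 (N div 2) - H2 N"
proof -
  have "(\<Sum>k=1..N. (-1)^k / rat_of_nat k ^ 2) + H2 N = (\<Sum>k=1..N. ((-1)^k + 1) / of_nat k ^ 2)"
    by (simp add: H2_def sum.distrib add_divide_distrib)
  also have "\<dots> = (\<Sum>j=1..N div 2. 1 / 2 * (1 / of_nat j ^ 2))"
    by (subst sum_split_parity) (simp add: sum.neutral power_mult_distrib)
  finally show ?thesis by (simp add: H2_def sum_distrib_left)
qed

text \<open>Creative telescoping in \<open>b\<close>: the polynomial parts telescope, while
  the poles at \<open>n = 0\<close> cancel.\<close>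

lemma choose_over_index_telescope:
  assumes "b > 0" "n \<ge> 2 * b + 1"
  shows "of_nat (b + 1) * (of_nat ((n - (b + 1) - 1) choose b) / of_nat n) +
         2 * of_nat (2 * b + 1) * (of_nat ((n - b - 1) choose (b - 1)) / of_nat n) =
         (of_nat (b + 1) / of_nat b * of_nat ((Suc n - b - 1) choose b) +
            of_nat ((Suc n - b - 2) choose (b - 1))) -
         (of_nat (b + 1) / of_nat b * of_nat ((n - b - 1) choose b) +
            rat_of_nat ((n - b - 2) choose (b - 1)))"
proof -
  obtain b' where b: "b = Suc b'" using assms gr0_implies_Suc by blast
  \<comment> \<open>In this parametrisation every binomial coefficient is a rational multiple of
    \<open>A\<close>, which leaves an identity between rational functions of \<open>w\<close> and
    \<open>b'\<close>.\<close>
  obtain w where n: "n = 2 * b + 1 + w" using assms le_Suc_ex by blast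
  define A where "A = rat_of_nat ((w + b') choose b')"
  have "of_nat (Suc b' * ((w + b') choose Suc b')) = (rat_of_nat (w * ((w + b') choose b')))"
    using binomial_absorb_comp[of "w + b'" b'] binomial_absorption[of b' "w + b'"]
    by (simp only: add_diff_cancel_right')
  hence "of_nat (Suc b') * of_nat ((w + b') choose Suc b') = of_nat w * A"
    by (simp only: of_nat_mult A_def)
  hence e1: "of_nat ((w + b') choose Suc b') = of_nat w * A / of_nat (Suc b')"
    by (simp only: eq_divide_eq mult.commute) simp
  have "of_nat (Suc w * (Suc (w + b') choose b')) = rat_of_nat (Suc (w + b') * ((w + b') choose b'))"
    using binomial_absorb_comp[of "Suc (w + b')" b'] by (simp only: Suc_diff_le) simp
  hence "of_nat (Suc w) * of_nat (Suc (w + b') choose b') = of_nat (Suc (w + b')) * A"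
    by (simp only: of_nat_mult A_def)
  hence e2: "of_nat (Suc (w + b') choose b') = of_nat (Suc (w + b')) * A / of_nat (Suc w)"
    by (simp only: eq_divide_eq mult.commute) simp
  have e3: "rat_of_nat (Suc (w + b') choose Suc b') = A + of_nat ((w + b') choose Suc b')"
    by (simp add: A_def)
  have e4: "rat_of_nat (Suc (Suc (w + b')) choose Suc b') =
            of_nat (Suc (w + b') choose b') + of_nat (Suc (w + b') choose Suc b')"
    by simp
  have i: "n - (b + 1) - 1 = w + b'" "n - b - 1 = Suc (w + b')" "Suc n - b - 1 = Suc (Suc (w + b'))"
     "Suc n - b - 2 = Suc (w + b')" "n - b - 2 = w + b'" "b - 1 = b'"
    by (simp_all add: n b)
  have n': "rat_of_nat n = 2 * of_nat b' + of_nat w + 3" by (simp add: n b)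
  have nz: "of_nat w + 1 \<noteq> (0 :: rat)" "of_nat b' + 1 \<noteq> (0 :: rat)"
     "2 * of_nat b' + of_nat w + 3 \<noteq> (0 :: rat)"
    using of_nat_neq_0[of w, where ?'a = rat] of_nat_neq_0[of b', where ?'a = rat]
      of_nat_neq_0[of "2 * b' + w + 2", where ?'a = rat] by (simp_all add: algebra_simps)
  have s: "rat_of_nat (Suc b') = of_nat b' + 1" "rat_of_nat (Suc w) = of_nat w + 1"
     "rat_of_nat (Suc b' + 1) = of_nat b' + 2" "rat_of_nat (2 * Suc b' + 1) = 2 * of_nat b' + 3"
     "rat_of_nat (Suc (w + b')) = of_nat w + of_nat b' + 1" by simp_all
  show ?thesis
    unfolding i n' unfolding b e4 e3 e2 e1 A_def[symmetric] s using nz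
    by (simp add: divide_simps) (simp add: algebra_simps)
qed

text \<open>The telescoping identity is summed from \<open>n = 2 * b + 1\<close>. There the first
  sum has a zero term, and the lower boundary value accounts exactly for the term
  \<open>n = 2 * b\<close> of the second sum.\<close>

lemma choose_over_index_sum_rec:
  assumes "b > 0" "2 * b + 2 < p"
  shows "of_nat (b + 1) * (\<Sum>n=2*(b+1)..<p. of_nat ((n - (b + 1) - 1) choose b) / of_nat n) +
         2 * of_nat (2 * b + 1) * (\<Sum>n=2*b..<p. of_nat ((n - b - 1) choose (b - 1)) / of_nat n) =
         of_nat (b + 1) / of_nat b * of_nat ((p - b - 1) choose b) +
            rat_of_nat ((p - b - 2) choose (b - 1))"
proof -
  define F where "F = (\<lambda>n. rat_of_nat ((n - b - 1) choose (b - 1)) / of_nat n)"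
  define F' where "F' = (\<lambda>n. rat_of_nat ((n - (b + 1) - 1) choose b) / of_nat n)"
  define G where "G = (\<lambda>n. of_nat (b + 1) / of_nat b * of_nat ((n - b - 1) choose b) +
            rat_of_nat ((n - b - 2) choose (b - 1)))"
  have "{2*b+1..<p} = insert (2*b+1) {2*(b+1)..<p}" using assms by auto
  hence 1: "(\<Sum>n=2*b+1..<p. F' n) = (\<Sum>n=2*(b+1)..<p. F' n)"
    using assms by (simp add: F'_def binomial_eq_0)
  have "{2*b..<p} = insert (2*b) {2*b+1..<p}" using assms by auto
  hence 2: "(\<Sum>n=2*b..<p. F n) = 1 / of_nat (2 * b) + (\<Sum>n=2*b+1..<p. F n)"
    by (simp add: F_def)
  have "of_nat (b + 1) * (\<Sum>n=2*b+1..<p. F' n) + 2 * of_nat (2 * b + 1) * (\<Sum>n=2*b+1..<p. F n) =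
        (\<Sum>n=2*b+1..<p. of_nat (b + 1) * F' n + 2 * of_nat (2 * b + 1) * F n)"
    by (simp only: sum.distrib sum_distrib_left)
  also have "\<dots> = (\<Sum>n=2*b+1..<p. G (Suc n) - G n)"
    unfolding F_def F'_def G_def using assms
    by (intro sum.cong refl choose_over_index_telescope) auto
  also have "\<dots> = G p - G (2 * b + 1)"
    using assms by (intro sum_Suc_diff') auto
  also have "G (2 * b + 1) = 2 * of_nat (2 * b + 1) * (1 / of_nat (2 * b))"
    using assms by (simp add: G_def field_simps)
  finally have "of_nat (b + 1) * (\<Sum>n=2*(b+1)..<p. F' n) + 2 * of_nat (2 * b + 1) * (\<Sum>n=2*b..<p. F n) = G p"
    unfolding 1 2 distrib_left by linarith
  thus ?thesis by (simp only: F_def F'_def G_def)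
qed

lemma central_choose_Suc:
  "of_nat ((2 * (b + 1)) choose (b + 1)) =
   2 * of_nat (2 * b + 1) / of_nat (b + 1) * (of_nat ((2 * b) choose b) :: 'a::field_char_0)"
proof -
  have "Suc b * ((2 * b + 1) choose Suc b) = (2 * b + 1) * ((2 * b) choose b)"
    using binomial_absorption[of b "2 * b + 1"] by simp
  moreover have "Suc b * ((2 * (b + 1)) choose (Suc b)) = 2 * (Suc b * ((2 * b + 1) choose b))"
    using binomial_absorption[of b "2 * (b + 1)"] by simp
  moreover have "(2 * b + 1) choose b = (2 * b + 1) choose Suc b"
    by (subst binomial_symmetric) auto
  ultimately have "Suc b * ((2 * (b + 1)) choose (b + 1)) = 2 * ((2 * b + 1) * ((2 * b) choose b))"
    by (simp only: Suc_eq_plus1)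
  hence "of_nat (Suc b * ((2 * (b + 1)) choose (b + 1))) =
         (of_nat (2 * ((2 * b + 1) * ((2 * b) choose b))) :: 'a)"
    by (simp only:)
  hence "of_nat (b + 1) * of_nat ((2 * (b + 1)) choose (b + 1)) =
         2 * of_nat (2 * b + 1) * (of_nat ((2 * b) choose b) :: 'a)"
    by (simp only: of_nat_mult of_nat_numeral Suc_eq_plus1 mult.assoc)
  moreover have "of_nat (b + 1) \<noteq> (0 :: 'a)"
    using of_nat_neq_0[of b] by simp
  ultimately show ?thesis
    by (metis nonzero_mult_div_cancel_left times_divide_eq_left)
qed

text \<open>Both sides are the quotient of \<open>fact (2 * m)\<close> by
  \<open>fact m * fact (p - 1 - m) * fact (2 * m - p)\<close>. The right side displays the factor
  \<open>p\<close>.\<close>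

lemma central_choose_top_term:
  assumes "p < 2 * m" "m < p"
  shows "m * ((2 * m) choose m) * ((m - 1) choose (p - 1 - m)) = p * ((p - 1) choose m) * ((2 * m) choose p)"
proof -
  define d where "d = p - 1 - m"
  define e where "e = 2 * m - p"
  have i: "2 * m - m = m" "m - 1 - d = e" "p - 1 - m = d" "2 * m - p = e"
          "d \<le> m - 1" "m \<le> p - 1" "p \<le> 2 * m" "m \<le> 2 * m"
    using assms unfolding d_def e_def by auto
  have m: "fact m = (of_nat m * fact (m - 1) :: rat)" and p: "fact p = (of_nat p * fact (p - 1) :: rat)"
    using assms fact_reduce[of m] fact_reduce[of p] by auto
  have pos: "of_nat m \<noteq> (0 :: rat)" "of_nat p \<noteq> (0 :: rat)" using assms by auto
  have "rat_of_nat (m * ((2 * m) choose m) * ((m - 1) choose (p - 1 - m))) =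
        fact (2 * m) / (fact m * fact d * fact e)"
    unfolding i of_nat_mult binomial_fact[OF i(5)] binomial_fact[OF i(8)] using pos by (simp add: m)
  also have "\<dots> = rat_of_nat (p * ((p - 1) choose m) * ((2 * m) choose p))"
    unfolding i of_nat_mult binomial_fact[OF i(6)] binomial_fact[OF i(7)] using pos by (simp add: p)
  finally show ?thesis by (simp only: of_nat_eq_iff)
qed

text \<open>The index \<open>m = 0\<close> gives the first sum; for the others absorption replaces
  \<open>(k choose m) / k\<close> by \<open>((k - 1) choose (m - 1)) / m\<close>, which frees the
  inner sum of denominators. It is applied with \<open>w k = 1\<close> and
  \<open>w k = p - k\<close>.\<close>

lemma weighted_sum_S:
  "(\<Sum>k=1..p-1. w k * S k / of_nat k ^ 2) =
   (\<Sum>k=1..p-1. w k / of_nat k ^ 2) +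
   (\<Sum>m=1..p-1. of_nat (2 * m + 1) / of_nat m ^ 2 *
      (of_nat ((2 * m) choose m) * (\<Sum>k=1..p-1. w k * of_nat (((k - 1) choose (m - 1))\<^sup>2))))"
proof -
  define f where "f = (\<lambda>k m. w k * rat_of_nat ((k choose m)\<^sup>2 * ((2 * m) choose m) * (2 * m + 1)) / of_nat k ^ 2)"
  have "(\<Sum>k=1..p-1. w k * S k / of_nat k ^ 2) = (\<Sum>k=1..p-1. \<Sum>m\<le>p-1. f k m)"
    by (intro sum.cong refl, subst S_altdef[of _ "p - 1"])
       (simp_all only: f_def sum_distrib_left sum_divide_distrib atLeastAtMost_iff)
  also have "\<dots> = (\<Sum>k=1..p-1. f k 0 + (\<Sum>m=1..p-1. f k m))"
    by (intro sum.cong refl) (simp add: sum.atLeast1_atMost_eq sum.atMost_shift atMost_atLeast0 sum.atLeast_Suc_atMost)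
  also have "\<dots> = (\<Sum>k=1..p-1. w k / of_nat k ^ 2) + (\<Sum>m=1..p-1. \<Sum>k=1..p-1. f k m)"
    by (simp add: sum.distrib f_def) (rule sum.swap)
  also have "(\<Sum>m=1..p-1. \<Sum>k=1..p-1. f k m) =
    (\<Sum>m=1..p-1. of_nat (2 * m + 1) / of_nat m ^ 2 *
      (of_nat ((2 * m) choose m) * (\<Sum>k=1..p-1. w k * of_nat (((k - 1) choose (m - 1))\<^sup>2))))"
    unfolding sum_distrib_left
  proof (intro sum.cong refl)
    fix m k assume m: "m \<in> {1..p-1}" and k: "k \<in> {1..p-1}"
    have "m * (k choose m) = k * ((k - 1) choose (m - 1))"
      using m by (intro times_binomial_minus1_eq) auto
    hence "rat_of_nat ((m * (k choose m))\<^sup>2) = of_nat ((k * ((k - 1) choose (m - 1)))\<^sup>2)"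
      by (simp only:)
    hence "rat_of_nat m ^ 2 * of_nat ((k choose m)\<^sup>2) = of_nat k ^ 2 * of_nat (((k - 1) choose (m - 1))\<^sup>2)"
      by (simp only: of_nat_mult of_nat_power power_mult_distrib)
    hence "rat_of_nat ((k choose m)\<^sup>2) / of_nat k ^ 2 = of_nat (((k - 1) choose (m - 1))\<^sup>2) / of_nat m ^ 2"
      using m k by (simp add: frac_eq_eq mult.commute)
    moreover have "f k m = w k * of_nat ((2 * m) choose m) * of_nat (2 * m + 1) *
        (rat_of_nat ((k choose m)\<^sup>2) / of_nat k ^ 2)"
      by (simp only: f_def of_nat_mult times_divide_eq_right mult_ac)
    ultimately show "f k m = of_nat (2 * m + 1) / of_nat m ^ 2 *
        (of_nat ((2 * m) choose m) * (w k * of_nat (((k - 1) choose (m - 1))\<^sup>2)))"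
      by (simp only: times_divide_eq_right times_divide_eq_left mult_ac)
  qed
  finally show ?thesis .
qed

section \<open>Wolstenholme's theorem and partial sums of inverse squares\<close>

context local_ring_gt_3
begin

text \<open>Wolstenholme's theorem: pairing \<open>k\<close> with \<open>p - k\<close> gives
  \<open>p / (k * (p - k))\<close>, and the cofactor of \<open>p\<close> sums to
  \<open>- H2 (p - 1)\<close> modulo \<open>p\<close>.\<close>

lemma sum_inverse_p_square_cong: "lcong (p\<^sup>2) (\<Sum>k=1..p-1. 1 / of_nat k) 0"
proof -
  have "(\<Sum>k=1..p-1. 1 / of_nat k) = (\<Sum>k=1..p-1. 1 / rat_of_nat (p - k))"
    by (rule sum.reindex_bij_witness[of _ "\<lambda>k. p - k" "\<lambda>k. p - k"]) auto
  hence "2 * (\<Sum>k=1..p-1. 1 / of_nat k) = (\<Sum>k=1..p-1. 1 / of_nat k + 1 / rat_of_nat (p - k))"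
    by (simp add: sum.distrib)
  also have "\<dots> = (\<Sum>k=1..p-1. of_nat p * (1 / of_nat k * (1 / rat_of_nat (p - k))))"
    by (intro sum.cong refl) (auto simp: of_nat_diff field_simps)
  also have "\<dots> = of_nat p * (\<Sum>k=1..p-1. 1 / of_nat k * (1 / rat_of_nat (p - k)))"
    by (simp add: sum_distrib_left)
  also have "lcong (p\<^sup>2) \<dots> (of_nat p * 0)"
  proof (rule lcong_p_scale)
    have "lcong p (\<Sum>k=1..p-1. 1 / of_nat k * (1 / rat_of_nat (p - k)))
                (\<Sum>k=1..p-1. 1 / of_nat k * (- (1 / rat_of_nat k)))"
      by (intro lcong_sum lcong_scale lcong_inverse_p_minus local_ints_divide_small) auto
    also have "(\<Sum>k=1..p-1. 1 / of_nat k * (- (1 / rat_of_nat k))) = - H2 (p - 1)"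
      by (simp add: H2_def power2_eq_square sum_negf)
    also have "lcong p (- H2 (p - 1)) (- 0)"
      by (intro lcong_minus H2_p_pred)
    finally show "lcong p (\<Sum>k=1..p-1. 1 / of_nat k * (1 / rat_of_nat (p - k))) 0" by simp
  qed
  finally have "lcong (p\<^sup>2) (2 * (\<Sum>k=1..p-1. 1 / of_nat k)) (2 * 0)" by simp
  thus ?thesis
    using p_gt_3 by (rule_tac lcong_cancel) (auto intro: local_ints_divide_numeral)
qed

text \<open>Under \<open>k\<close> to \<open>p - k\<close> the upper half of
  \<open>H2 (p - 1)\<close> equals the lower half modulo \<open>p\<close>.\<close>

lemma H2_half: "lcong p (H2 (p div 2)) 0"
proof -
  define M where "M = p div 2"
  have p: "p = 2 * M + 1" using odd_p by (simp add: M_def)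
  have "H2 (p - 1) = H2 M + (\<Sum>k=M+1..2*M. 1 / of_nat k ^ 2)"
    unfolding H2_def p using sum.ub_add_nat[of 1 M "\<lambda>k. 1 / rat_of_nat k ^ 2" M]
    by (simp add: mult_2)
  also have "(\<Sum>k=M+1..2*M. 1 / of_nat k ^ 2) = (\<Sum>k=1..M. 1 / rat_of_nat (p - k) ^ 2)"
    by (rule sum.reindex_bij_witness[of _ "\<lambda>k. p - k" "\<lambda>k. p - k"]) (auto simp: p)
  finally have "H2 (p - 1) = H2 M + (\<Sum>k=1..M. 1 / rat_of_nat (p - k) ^ 2)" .
  moreover have "lcong p (H2 M + (\<Sum>k=1..M. 1 / rat_of_nat (p - k) ^ 2)) (H2 M + H2 M)"
    unfolding H2_def by (intro lcong_add lcong_refl lcong_sum lcong_inverse_p_minus_square) (auto simp: p)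
  ultimately have "lcong p (2 * H2 M) (2 * 0)"
    using lcong_trans[OF lcong_sym H2_p_pred] by simp
  thus ?thesis unfolding M_def
    using p_gt_3 by (rule_tac lcong_cancel) (auto intro: local_ints_divide_numeral)
qed

text \<open>Split \<open>H2 (p div 3)\<close> by parity. The even part is a quarter of the left
  side. The odd \<open>k\<close> are \<open>p - 2 * j\<close> for \<open>j\<close> between
  \<open>p / 3\<close> and \<open>p / 2\<close>, so they give a quarter of
  \<open>H2 (p div 2) - H2 (p div 3)\<close>, where the first term vanishes.\<close>

lemma H2_sixth: "lcong p (H2 (p div 3 div 2)) (5 * H2 (p div 3))"
proof -
  define q where "q = p div 3"
  define M where "M = p div 2"
  have p: "p = 2 * M + 1" using odd_p by (simp add: M_def)
  have q: "3 * q < p" "p < 3 * q + 3" using p_mod_3 unfolding q_def by presburger+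
  have quarter: "1 / 4 \<in> local_ints p"
    using p_gt_3 local_ints_mult[of "1 / 2" p "1 / 2"] local_ints_divide_numeral[of 1 "num.Bit0 num.One"] by simp
  have "H2 q = (\<Sum>j=1..q div 2. 1 / of_nat (2 * j) ^ 2) + (\<Sum>k\<in>{k\<in>{1..q}. odd k}. 1 / of_nat k ^ 2)"
    unfolding H2_def by (rule sum_split_parity)
  also have "(\<Sum>j=1..q div 2. 1 / of_nat (2 * j) ^ 2) = 1 / 4 * H2 (q div 2)"
    by (simp add: H2_def sum_distrib_left power_mult_distrib)
  also have "(\<Sum>k\<in>{k\<in>{1..q}. odd k}. 1 / of_nat k ^ 2) = (\<Sum>j=q+1..M. 1 / rat_of_nat (p - 2 * j) ^ 2)"
  proof -
    have "(p - k) div 2 \<in> {q+1..M}" "p - 2 * ((p - k) div 2) = k" if k: "k \<in> {1..q}" "odd k" for k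
    proof -
      obtain c where c: "k = 2 * c + 1" using k by (auto elim: oddE)
      hence *: "(p - k) div 2 = M - c" by (simp add: p)
      show "(p - k) div 2 \<in> {q+1..M}" using k q unfolding * by (auto simp: c p)
      show "p - 2 * ((p - k) div 2) = k" using k q unfolding * by (auto simp: c p)
    qed
    moreover have "p - 2 * j \<in> {k\<in>{1..q}. odd k}" "(p - (p - 2 * j)) div 2 = j" if "j \<in> {q+1..M}" for j
      using that q unfolding p by auto
    ultimately show ?thesis
      by (intro sum.reindex_bij_witness[of _ "\<lambda>j. p - 2 * j" "\<lambda>k. (p - k) div 2"]) auto
  qed
  finally have 1: "H2 q = 1 / 4 * H2 (q div 2) + (\<Sum>j=q+1..M. 1 / rat_of_nat (p - 2 * j) ^ 2)" .
  have "lcong p (\<Sum>j=q+1..M. 1 / rat_of_nat (p - 2 * j) ^ 2) (\<Sum>j=q+1..M. 1 / rat_of_nat (2 * j) ^ 2)"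
    by (intro lcong_sum lcong_inverse_p_minus_square) (auto simp: p)
  also have "(\<Sum>j=q+1..M. 1 / rat_of_nat (2 * j) ^ 2) = 1 / 4 * (H2 M - H2 q)"
  proof -
    have "q \<le> M" using q p by linarith
    hence "H2 M - H2 q = (\<Sum>j=q+1..M. 1 / rat_of_nat j ^ 2)"
      unfolding H2_def using sum.ub_add_nat[of 1 q "\<lambda>k. 1 / rat_of_nat k ^ 2" "M - q"] by simp
    thus ?thesis by (simp add: sum_distrib_left power_mult_distrib)
  qed
  also have "lcong p \<dots> (1 / 4 * (0 - H2 q))"
    using quarter unfolding M_def by (intro lcong_scale lcong_diff H2_half lcong_refl)
  finally have "lcong p (4 * (H2 q - 1 / 4 * H2 (q div 2))) (4 * (1 / 4 * (0 - H2 q)))"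
    using 1 by (intro lcong_scale) auto
  hence "lcong p (4 * H2 q - H2 (q div 2)) (- H2 q)"
    by (simp add: algebra_simps)
  from lcong_diff[OF lcong_refl[of p "4 * H2 q"] this] show ?thesis
    by (simp add: q_def)
qed

text \<open>Write \<open>hexagonal n\<close> as \<open>(-1) ^ n\<close> times \<open>3\<close> on
  the multiples of \<open>3\<close>, minus \<open>(-1) ^ n\<close> throughout. Both alternating sums
  reduce to values of \<open>H2\<close>, and \<open>1 / 3 * (5 / 2 - 1) = 1 / 2\<close>.\<close>

lemma hexagonal_sum_cong: "lcong p (\<Sum>n=1..p-1. hexagonal n / of_nat n ^ 2) (1 / 2 * H2 (p div 3))"
proof -
  define q where "q = p div 3"
  have q: "(p - 1) div 3 = q" using p_mod_3 unfolding q_def by presburger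
  have M: "(p - 1) div 2 = p div 2" using odd_p by presburger
  have "(\<Sum>n=1..p-1. hexagonal n / of_nat n ^ 2) =
        (\<Sum>n=1..p-1. 3 * (if 3 dvd n then (-1)^n / of_nat n ^ 2 else 0) - (-1)^n / of_nat n ^ 2)"
    by (intro sum.cong) (auto simp: hexagonal_def algebra_simps)
  also have "\<dots> = 3 * (\<Sum>n=1..p-1. if 3 dvd n then (-1)^n / of_nat n ^ 2 else 0) -
                 (\<Sum>n=1..p-1. (-1)^n / rat_of_nat n ^ 2)"
    by (simp only: sum_subtractf sum_distrib_left)
  also have "(\<Sum>n=1..p-1. if 3 dvd n then (-1)^n / of_nat n ^ 2 else 0) =
             1 / 9 * (\<Sum>j=1..q. (-1)^j / rat_of_nat j ^ 2)"
    by (subst sum_multiples_of_3) (simp add: q[unfolded One_nat_def] sum_distrib_left power_mult_distrib power_mult)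
  also have "3 * (1 / 9 * (\<Sum>j=1..q. (-1)^j / rat_of_nat j ^ 2)) - (\<Sum>n=1..p-1. (-1)^n / rat_of_nat n ^ 2) =
             1 / 3 * (1 / 2 * H2 (q div 2) - H2 q) - (1 / 2 * H2 (p div 2) - H2 (p - 1))"
    by (simp only: alternating_inverse_squares M)
  also have "lcong p \<dots> (1 / 3 * (1 / 2 * (5 * H2 q) - H2 q) - (1 / 2 * 0 - 0))"
    using p_gt_3 unfolding q_def
    by (intro lcong_diff lcong_scale lcong_refl H2_sixth H2_half H2_p_pred) (auto intro: local_ints_divide_numeral)
  finally show ?thesis by (simp add: q_def)
qed

section \<open>Central binomial coefficients over b and over its square\<close>

text \<open>Induction on \<open>b\<close>: the base case is the harmonic sum, and modulo
  \<open>p\<close> the closed form obeys \<open>choose_over_index_sum_rec\<close> once the boundary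
  terms at \<open>p\<close> are reduced.\<close>

lemma choose_over_index_sum_cong:
  assumes "b > 0" "2 * b < p"
  shows "lcong p (\<Sum>n=2*b..<p. of_nat ((n - b - 1) choose (b - 1)) / of_nat n)
                 ((-1)^b * of_nat ((2 * b) choose b) / (2 * of_nat b))"
  using assms
proof (induction b rule: nat_induct_non_zero)
  case 1
  have "{1..p-1} = insert 1 {2..<p}" using p_gt_3 by auto
  hence "(\<Sum>n=2..<p. 1 / of_nat n) = (\<Sum>n=1..p-1. 1 / rat_of_nat n) - 1"
    by simp
  also have "lcong p \<dots> (0 - 1)"
    by (intro lcong_diff lcong_p_square_imp[OF sum_inverse_p_square_cong] lcong_refl)
  finally show ?case by (simp add: numeral_2_eq_2)
next
  case (Suc b)
  define C where "C = rat_of_nat ((2 * b) choose b)"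
  define I where "I = (\<lambda>b. \<Sum>n=2*b..<p. rat_of_nat ((n - b - 1) choose (b - 1)) / of_nat n)"
  have b: "b > 0" "2 * b + 2 < p" using Suc.prems Suc.hyps by auto
  have IH: "lcong p (I b) ((-1)^b * C / (2 * of_nat b))"
    using Suc unfolding I_def C_def by simp
  \<comment> \<open>The boundary term \<open>(p - b - 2) choose (b - 1)\<close> reduces, up to sign,
    to this neighbour of the central coefficient.\<close>
  have c2: "of_nat ((2 * b) choose (b - 1)) = of_nat b / of_nat (b + 1) * C"
  proof -
    obtain b' where b': "b = Suc b'" using b gr0_implies_Suc by blast
    have "Suc b' * ((2 * b) choose Suc b') = (2 * b - b') * ((2 * b) choose b')"
      using binomial_absorption[of b' "2 * b"] binomial_absorb_comp[of "2 * b" b'] by (simp only:)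
    hence "of_nat (Suc b' * ((2 * b) choose Suc b')) = rat_of_nat ((b + 1) * ((2 * b) choose b'))"
      by (simp only:) (simp add: b')
    hence "of_nat b * C = of_nat (b + 1) * of_nat ((2 * b) choose (b - 1))"
      by (simp only: of_nat_mult C_def b' diff_Suc_1)
    moreover have "rat_of_nat (b + 1) \<noteq> 0" using of_nat_neq_0[of b] by simp
    ultimately have "of_nat ((2 * b) choose (b - 1)) = of_nat b * C / of_nat (b + 1)"
      by (simp only: nonzero_mult_div_cancel_left not_False_eq_True)
    thus ?thesis by (simp only: times_divide_eq_left)
  qed
  have rec: "of_nat (b + 1) * I (b + 1) =
        of_nat (b + 1) / of_nat b * of_nat ((p - 1 - b) choose b) +
            rat_of_nat ((p - 1 - (b + 1)) choose (b - 1)) - 2 * of_nat (2 * b + 1) * I b"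
    using choose_over_index_sum_rec[OF b] unfolding I_def by (simp add: algebra_simps)
  have 1: "lcong p (of_nat (b + 1) / of_nat b * of_nat ((p - 1 - b) choose b))
                   (of_nat (b + 1) / of_nat b * ((-1)^b * of_nat ((b + b) choose b)))"
    using b by (intro lcong_scale choose_p_minus_cong local_ints_divide_small local_ints_of_nat) auto
  have 2: "lcong p (of_nat ((p - 1 - (b + 1)) choose (b - 1)))
                   ((-1)^(b - 1) * of_nat ((b + 1 + (b - 1)) choose (b - 1)))"
    using b by (intro choose_p_minus_cong) auto
  have 3: "lcong p (2 * of_nat (2 * b + 1) * I b) (2 * of_nat (2 * b + 1) * ((-1)^b * C / (2 * of_nat b)))"
    by (intro lcong_scale IH local_ints_mult local_ints_of_nat local_ints_numeral)
  have 4: "of_nat (b + 1) / of_nat b * ((-1)^b * of_nat ((b + b) choose b)) +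
        (-1)^(b - 1) * of_nat ((b + 1 + (b - 1)) choose (b - 1)) -
        2 * of_nat (2 * b + 1) * ((-1)^b * C / (2 * of_nat b)) =
        of_nat (b + 1) / of_nat b * ((-1)^b * C) - (-1)^b * (of_nat b / of_nat (b + 1) * C) -
        2 * of_nat (2 * b + 1) * ((-1)^b * C / (2 * of_nat b))"
  proof -
    have "(-1)^(b - 1) = (- ((-1)^b) :: rat)" using b by (cases b) auto
    moreover have "b + 1 + (b - 1) = 2 * b" "b + b = 2 * b" using b by auto
    ultimately show ?thesis by (simp only: c2 C_def[symmetric] mult_minus_left add_uminus_conv_diff)
  qed
  have 5: "\<dots> = of_nat (b + 1) * ((-1)^(b + 1) * of_nat ((2 * (b + 1)) choose (b + 1)) / (2 * of_nat (b + 1)))"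
  proof -
    have nz: "of_nat b + 1 \<noteq> (0 :: rat)" using of_nat_neq_0[of b, where ?'a = rat] by (simp add: add.commute)
    have s: "rat_of_nat (b + 1) = of_nat b + 1" "rat_of_nat (2 * b + 1) = 2 * of_nat b + 1" by simp_all
    show ?thesis unfolding central_choose_Suc C_def[symmetric] s using nz b
      by (simp add: divide_simps) (simp add: algebra_simps)
  qed
  have "lcong p (of_nat (b + 1) * I (b + 1))
          (of_nat (b + 1) * ((-1)^(b + 1) * of_nat ((2 * (b + 1)) choose (b + 1)) / (2 * of_nat (b + 1))))"
    using lcong_diff[OF lcong_add[OF 1 2] 3] unfolding rec 4 5 .
  hence "lcong p (I (b + 1)) ((-1)^(b + 1) * of_nat ((2 * (b + 1)) choose (b + 1)) / (2 * of_nat (b + 1)))"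
    by (rule lcong_cancel)
       (use b in \<open>auto intro!: local_ints_divide_small simp del: of_nat_add of_nat_Suc\<close>)
  thus ?case by (simp only: I_def Suc_eq_plus1)
qed

text \<open>In the hexagonal expansion at \<open>n = p\<close> the left side is \<open>1\<close>, so
  the sum there vanishes exactly; modulo \<open>p\<close> its terms are \<open>- 1 / 2\<close> times
  those here.\<close>

lemma central_choose_log_cong:
  "lcong p (\<Sum>b=1..p div 2. of_nat ((2 * b) choose b) / of_nat b) 0"
proof -
  have "hexagonal p = 1"
    using odd_p p_mod_3 by (auto simp: hexagonal_def)
  hence z: "(\<Sum>b=1..p div 2. (-1)^b / of_nat b * rat_of_nat ((p - b - 1) choose (b - 1))) = 0"
    using hexagonal_expansion[OF p_gt_0] p_gt_0 by simp
  have "lcong p (-2 * (\<Sum>b=1..p div 2. (-1)^b / of_nat b * rat_of_nat ((p - 1 - b) choose (b - 1))))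
            (-2 * (\<Sum>b=1..p div 2. (-1)^b / of_nat b * ((-1)^(b - 1) * rat_of_nat ((b + (b - 1)) choose (b - 1)))))"
    using odd_p by (intro lcong_scale lcong_sum choose_p_minus_cong local_ints_divide_small
       local_ints_power local_ints_uminus) (auto elim!: oddE)
  also have "-2 * (\<Sum>b=1..p div 2. (-1)^b / of_nat b * ((-1)^(b - 1) * rat_of_nat ((b + (b - 1)) choose (b - 1)))) =
             (\<Sum>b=1..p div 2. of_nat ((2 * b) choose b) / of_nat b)"
    unfolding sum_distrib_left
  proof (intro sum.cong refl)
    fix b assume "b \<in> {1..p div 2}"
    then obtain c where b: "b = Suc c" by (cases b) auto
    have "(2 * b) choose b = 2 * ((b + c) choose c)"
    proof -
      have "(Suc c + c) choose Suc c = (Suc c + c) choose c"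
        by (subst binomial_symmetric) auto
      thus ?thesis by (simp add: b mult_2)
    qed
    thus "-2 * ((-1)^b / of_nat b * ((-1)^(b - 1) * rat_of_nat ((b + (b - 1)) choose (b - 1)))) =
          of_nat ((2 * b) choose b) / of_nat b"
      by (simp add: b power_mult_distrib[symmetric] del: binomial_Suc_Suc of_nat_Suc)
  qed
  also have "-2 * (\<Sum>b=1..p div 2. (-1)^b / of_nat b * rat_of_nat ((p - 1 - b) choose (b - 1))) = 0"
    using z by (simp add: diff_right_commute)
  finally show ?thesis by (rule lcong_sym)
qed

text \<open>Divide the hexagonal expansion by \<open>n ^ 2\<close> and sum over \<open>n\<close>:
  the constant \<open>1\<close> contributes \<open>H2 (p - 1)\<close>, which vanishes, and after
  exchanging sums the inner sum is that of \<open>choose_over_index_sum_cong\<close>.\<close>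

lemma central_choose_dilog_cong:
  "lcong p (\<Sum>b=1..p div 2. of_nat ((2 * b) choose b) / of_nat b ^ 2)
           (2 * (\<Sum>n=1..p-1. hexagonal n / of_nat n ^ 2))"
proof -
  define h where "h = (\<lambda>b n. (-1)^b / of_nat b * (rat_of_nat ((n - b - 1) choose (b - 1)) / of_nat n))"
  define T where "T = (\<Sum>b=1..p div 2. \<Sum>n=2*b..<p. h b n)"
  have "(\<Sum>n=1..p-1. hexagonal n / of_nat n ^ 2) =
        (\<Sum>n=1..p-1. 1 / of_nat n ^ 2 + (\<Sum>b=1..n div 2. h b n))"
  proof (intro sum.cong refl)
    fix n assume n: "n \<in> {1..p-1}"
    define X where "X = (\<Sum>b=1..n div 2. (-1)^b / of_nat b * rat_of_nat ((n - b - 1) choose (b - 1)))"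
    have "hexagonal n = 1 + of_nat n * X"
      unfolding X_def using n by (intro hexagonal_expansion) auto
    moreover have "(\<Sum>b=1..n div 2. h b n) = X / of_nat n"
      by (simp add: h_def X_def sum_divide_distrib)
    ultimately show "hexagonal n / of_nat n ^ 2 = 1 / of_nat n ^ 2 + (\<Sum>b=1..n div 2. h b n)"
      using n by (simp add: field_simps power2_eq_square)
  qed
  also have "\<dots> = H2 (p - 1) + (\<Sum>n=1..p-1. \<Sum>b=1..n div 2. h b n)"
    by (simp add: sum.distrib H2_def)
  also have "(\<Sum>n=1..p-1. \<Sum>b=1..n div 2. h b n) = T"
    unfolding T_def sum.Sigma[OF finite_atLeastAtMost ballI[OF finite_atLeastAtMost]]
      sum.Sigma[OF finite_atLeastAtMost ballI[OF finite_atLeastLessThan]]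
    by (rule sum.reindex_bij_witness[of _ "\<lambda>(b, n). (n, b)" "\<lambda>(n, b). (b, n)"]) auto
  finally have 1: "(\<Sum>n=1..p-1. hexagonal n / of_nat n ^ 2) = H2 (p - 1) + T" .
  have "lcong p T (\<Sum>b=1..p div 2. 1 / 2 * (of_nat ((2 * b) choose b) / of_nat b ^ 2))"
    unfolding T_def
  proof (rule lcong_sum)
    fix b assume "b \<in> {1..p div 2}"
    moreover have "2 * (p div 2) < p" using odd_p by presburger
    ultimately have b: "b > 0" "2 * b < p" by auto
    have "lcong p ((-1)^b / of_nat b * (\<Sum>n=2*b..<p. of_nat ((n - b - 1) choose (b - 1)) / of_nat n))
            ((-1)^b / of_nat b * ((-1)^b * of_nat ((2 * b) choose b) / (2 * of_nat b)))"
      using b by (intro lcong_scale choose_over_index_sum_cong local_ints_divide_small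
          local_ints_power local_ints_uminus) auto
    moreover have "(-1)^b / of_nat b * ((-1)^b * of_nat ((2 * b) choose b) / (2 * of_nat b)) =
                   1 / 2 * (rat_of_nat ((2 * b) choose b) / of_nat b ^ 2)"
      by (simp add: power2_eq_square power_mult_distrib[symmetric])
    ultimately show "lcong p (\<Sum>n=2*b..<p. h b n) (1 / 2 * (of_nat ((2 * b) choose b) / of_nat b ^ 2))"
      by (simp only: h_def sum_distrib_left)
  qed
  hence "lcong p T (1 / 2 * (\<Sum>b=1..p div 2. of_nat ((2 * b) choose b) / of_nat b ^ 2))"
    by (simp only: sum_distrib_left)
  from lcong_scale[OF lcong_add[OF H2_p_pred this], of 2]
  show ?thesis unfolding 1 by (rule_tac lcong_sym) simp
qed

text \<open>Terms beyond \<open>p div 2\<close> vanish. Since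
  \<open>(2 * m + 1) / m ^ 2 = 2 / m + 1 / m ^ 2\<close>, the rest splits into the two preceding
  sums.\<close>

lemma sum_central_choose_cong:
  "lcong p (\<Sum>m=1..p-1. of_nat ((2 * m + 1) * ((2 * m) choose m)) / of_nat m ^ 2)
           (1 / 2 * of_int (Legendre (int p) 3) * poly (bernoulli_poly (p - 2)) (1 / 3))"
proof -
  define f where "f = (\<lambda>m. rat_of_nat ((2 * m + 1) * ((2 * m) choose m)) / of_nat m ^ 2)"
  have "{1..p-1} = {1..p div 2} \<union> {p div 2 + 1..p - 1}" using p_gt_3 by auto
  hence 1: "(\<Sum>m=1..p-1. f m) = (\<Sum>m=1..p div 2. f m) + (\<Sum>m=p div 2+1..p-1. f m)"
    by (simp only:) (intro sum.union_disjoint; auto)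
  have "lcong p (\<Sum>m=p div 2+1..p-1. f m) (\<Sum>m=p div 2+1..p-1. 0)"
  proof (rule lcong_sum)
    fix m assume m: "m \<in> {p div 2 + 1..p - 1}"
    have "lcong p (of_nat (2 * m + 1) / of_nat m ^ 2 * of_nat ((2 * m) choose m))
                  (of_nat (2 * m + 1) / of_nat m ^ 2 * 0)"
      using m by (intro lcong_scale central_choose_cong_0 local_ints_divide_small_power) auto
    thus "lcong p (f m) 0" by (simp only: f_def of_nat_mult times_divide_eq_left mult_zero_right)
  qed
  hence 2: "lcong p (\<Sum>m=p div 2+1..p-1. f m) 0" by simp
  have 3: "(\<Sum>m=1..p div 2. f m) =
             2 * (\<Sum>m=1..p div 2. of_nat ((2 * m) choose m) / of_nat m) +
             (\<Sum>m=1..p div 2. of_nat ((2 * m) choose m) / of_nat m ^ 2)"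
    unfolding sum_distrib_left sum.distrib[symmetric]
    by (intro sum.cong refl) (auto simp: f_def field_simps power2_eq_square)
  have 4: "lcong p (\<Sum>m=1..p div 2. f m) (2 * 0 + 2 * (\<Sum>n=1..p-1. hexagonal n / of_nat n ^ 2))"
    unfolding 3 by (intro lcong_add lcong_scale central_choose_log_cong central_choose_dilog_cong) auto
  have "lcong p (2 * (\<Sum>n=1..p-1. hexagonal n / of_nat n ^ 2)) (2 * (1 / 2 * H2 (p div 3)))"
    by (intro lcong_scale hexagonal_sum_cong) auto
  hence "lcong p (\<Sum>m=1..p div 2. f m) (H2 (p div 3))"
    using 4 by (auto intro: lcong_trans)
  hence "lcong p (\<Sum>m=1..p-1. f m) (H2 (p div 3))"
    using lcong_add[OF _ 2] unfolding 1 by fastforce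
  from lcong_trans[OF this H2_third] show ?thesis by (simp only: f_def)
qed

section \<open>Inner sums of squared binomial coefficients\<close>

text \<open>Either the central coefficient is divisible by \<open>p\<close>, or all lower indices in
  \<open>sum_square_choose\<close> are at most \<open>2 * m - 1 < p\<close>.\<close>

lemma central_choose_square_sum_cong:
  assumes "0 < m" "m < p"
  shows "lcong p (of_nat (((2 * m) choose m) * (\<Sum>k<p. (k choose (m - 1))\<^sup>2))) 0"
proof (cases "p \<le> 2 * m")
  case True
  from lcong_scale[OF central_choose_cong_0[OF True assms(2)], of "of_nat (\<Sum>k<p. (k choose (m - 1))\<^sup>2)"]
  show ?thesis by (simp only: of_nat_mult local_ints_of_nat mult.commute mult_zero_left)
next
  case False
  have "p dvd (\<Sum>k<p. (k choose (m - 1))\<^sup>2)"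
    unfolding sum_square_choose using False assms prime
    by (intro dvd_sum dvd_mult2 dvd_choose_prime) auto
  thus ?thesis by (intro lcong_of_nat_dvd) simp
qed

text \<open>All lower indices \<open>a + j + 2\<close> stay below \<open>p\<close>, so
  \<open>choose_p_cong\<close> leaves \<open>p\<close> times a Legendre moment, whose value is, up
  to sign, the inverse of the central coefficient.\<close>

lemma central_choose_weighted_square_sum_cong_small:
  assumes "2 * (a + 1) < p"
  shows "lcong (p\<^sup>2) (of_nat (((2 * a + 2) choose (a + 1)) * (\<Sum>k<p. (p - 1 - k) * (k choose a)\<^sup>2)))
                      (- of_nat p)"
proof -
  define C where "C = rat_of_nat ((2 * a + 2) choose (a + 1))"
  have C: "C \<noteq> 0" by (simp add: C_def del: binomial_Suc_Suc)
  have "lcong (p\<^sup>2) (of_nat (p choose (a + j + 2)) * of_nat (((a + j) choose a) * (a choose j)))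
          ((-1)^(a + j + 1) * of_nat p / of_nat (a + j + 2) * of_nat (((a + j) choose a) * (a choose j)))"
    if j: "j \<in> {..a}" for j
  proof -
    have "lcong (p\<^sup>2) (of_nat (p choose (a + j + 1 + 1)))
            ((-1)^(a + j + 1) * of_nat p / of_nat (a + j + 1 + 1))"
      using j assms by (intro choose_p_cong) auto
    from lcong_scale[OF this, of "of_nat (((a + j) choose a) * (a choose j))"] show ?thesis
      by (simp add: mult.commute)
  qed
  hence "lcong (p\<^sup>2) (\<Sum>j\<le>a. of_nat (p choose (a + j + 2)) * of_nat (((a + j) choose a) * (a choose j)))
          (\<Sum>j\<le>a. (-1)^(a + j + 1) * of_nat p / of_nat (a + j + 2) * of_nat (((a + j) choose a) * (a choose j)))"
    by (rule lcong_sum)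
  also have "(\<Sum>j\<le>a. (-1)^(a + j + 1) * of_nat p / of_nat (a + j + 2) * of_nat (((a + j) choose a) * (a choose j))) =
             - ((-1)^a * of_nat p * (\<Sum>j\<le>a. (-1)^j * of_nat (a choose j) * of_nat ((a + j) choose a) / rat_of_nat (a + j + 2)))"
    unfolding sum_distrib_left sum_negf[symmetric]
    by (intro sum.cong refl) (simp add: power_add mult_ac)
  also have "\<dots> = - (of_nat p / C)"
    unfolding legendre_moment C_def by (simp add: power_mult_distrib[symmetric] del: binomial_Suc_Suc)
  also have "(\<Sum>j\<le>a. of_nat (p choose (a + j + 2)) * of_nat (((a + j) choose a) * (a choose j))) =
             rat_of_nat (\<Sum>k<p. (p - 1 - k) * (k choose a)\<^sup>2)"
    unfolding sum_weighted_square_choose by (simp add: mult.assoc)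
  finally have "lcong (p\<^sup>2) (C * rat_of_nat (\<Sum>k<p. (p - 1 - k) * (k choose a)\<^sup>2)) (C * (- (of_nat p / C)))"
    by (rule lcong_scale) (simp add: C_def)
  moreover have "C * (- (of_nat p / C)) = - of_nat p" using C by simp
  ultimately show ?thesis by (simp only: C_def of_nat_mult)
qed

text \<open>The central coefficient is divisible by \<open>p\<close>, so the weighted sum matters
  only modulo \<open>p\<close>; there only the term with \<open>p choose p\<close> survives. The
  product is then evaluated by \<open>central_choose_top_term\<close>.\<close>

lemma central_choose_weighted_square_sum_cong_large:
  assumes "p < 2 * m" "m < p"
  shows "lcong (p\<^sup>2) (of_nat (((2 * m) choose m) * (\<Sum>k<p. (p - 1 - k) * (k choose (m - 1))\<^sup>2)))
                      (- of_nat p)"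
proof -
  define a where "a = m - 1"
  define C where "C = rat_of_nat ((2 * m) choose m)"
  define W where "W = rat_of_nat (\<Sum>k<p. (p - 1 - k) * (k choose a)\<^sup>2)"
  \<comment> \<open>The index with \<open>a + j + 2 = p\<close>.\<close>
  define j where "j = p - 1 - m"
  define t where "t = rat_of_nat (((p - 2) choose a) * (a choose j))"
  have a: "m = a + 1" "a + j + 2 = p" "a + j = p - 2" "j \<le> a" using assms unfolding a_def j_def by auto
  define g where "g = (\<lambda>i. (p choose (a + i + 2)) * ((a + i) choose a) * (a choose i))"
  have "W = of_nat (g j) + (\<Sum>i\<in>{..a} - {j}. of_nat (g i))"
    unfolding W_def sum_weighted_square_choose g_def[symmetric] of_nat_sum
    using a by (intro sum.remove) auto
  moreover have "lcong p (\<Sum>i\<in>{..a} - {j}. of_nat (g i)) (\<Sum>i\<in>{..a} - {j}. 0)"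
  proof (rule lcong_sum)
    fix i assume "i \<in> {..a} - {j}"
    hence "a + i + 2 \<noteq> p" using a by auto
    hence "p dvd (p choose (a + i + 2))"
      using prime p_gt_0 by (cases "a + i + 2 < p") (auto intro!: dvd_choose_prime simp: binomial_eq_0)
    thus "lcong p (of_nat (g i)) 0"
      unfolding g_def by (intro lcong_of_nat_dvd dvd_mult2)
  qed
  moreover have "g j = ((p - 2) choose a) * (a choose j)"
    by (simp only: g_def a(2) binomial_n_n mult_1) (simp only: a(3))
  hence "rat_of_nat (g j) = t" by (simp only: t_def)
  ultimately have "lcong p W t"
    using lcong_add[OF lcong_refl[of p t], of _ 0] by simp
  hence CW: "lcong (p\<^sup>2) (C * W) (C * t)"
    unfolding C_def using assms by (intro lcong_0_mult central_choose_cong_0) auto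
  have "lcong p (of_nat ((p - 1) choose m) * of_nat ((p - 1) choose m) * of_nat ((2 * m) choose p))
                ((-1)^m * (-1)^m * 1)"
    using assms by (intro lcong_mult choose_p_pred_cong choose_p_cong_1) auto
  from lcong_p_scale[OF this]
  have "lcong (p\<^sup>2) (of_nat p * (of_nat ((p - 1) choose m) * of_nat ((p - 1) choose m) * of_nat ((2 * m) choose p)))
                (of_nat p)" by (simp add: power_mult_distrib[symmetric])
  also have "of_nat p * (of_nat ((p - 1) choose m) * of_nat ((p - 1) choose m) * of_nat ((2 * m) choose p)) =
             rat_of_nat (((p - 1) choose m) * (p * ((p - 1) choose m) * ((2 * m) choose p)))"
    by simp
  also have "((p - 1) choose m) * (p * ((p - 1) choose m) * ((2 * m) choose p)) =
             (m * ((p - 1) choose m)) * (((2 * m) choose m) * (a choose j))"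
    unfolding central_choose_top_term[OF assms, symmetric] a_def j_def by (simp only: mult_ac)
  also have "m * ((p - 1) choose m) = (p - 1) * ((p - 2) choose a)"
  proof -
    have "p - 1 - 1 = p - 2" "0 < m" using assms by auto
    thus ?thesis using times_binomial_minus1_eq[of m "p - 1"] by (simp only: a_def)
  qed
  also have "rat_of_nat ((p - 1) * ((p - 2) choose a) * (((2 * m) choose m) * (a choose j))) =
             of_nat (p - 1) * (C * t)"
    by (simp only: C_def t_def of_nat_mult mult_ac)
  finally have 1: "lcong (p\<^sup>2) (of_nat (p - 1) * (C * t)) (of_nat p)" .
  \<comment> \<open>Rewriting \<open>p\<close> modulo \<open>p\<^sup>2\<close> as a multiple of
    \<open>p - 1\<close> makes it possible to cancel \<open>p - 1\<close>.\<close>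
  have "of_nat (p - 1) * (- of_nat p) = (of_nat p - of_nat (p\<^sup>2) :: rat)"
    using p_gt_0 by (simp add: of_nat_diff algebra_simps power2_eq_square)
  hence 2: "lcong (p\<^sup>2) (of_nat p) (of_nat (p - 1) * (- of_nat p))"
    unfolding lcong_def using p_gt_0 by (simp only:) simp
  have "lcong (p\<^sup>2) (C * t) (- of_nat p)"
    using lcong_trans[OF 1 2] by (rule lcong_cancel) (use p_gt_1 in \<open>auto intro!: local_ints_divide_small simp del: of_nat_diff\<close>)
  from lcong_trans[OF CW this] show ?thesis
    by (simp only: C_def W_def a_def of_nat_mult)
qed

lemma central_choose_weighted_square_sum_cong:
  assumes "0 < m" "m < p"
  shows "lcong (p\<^sup>2) (of_nat (((2 * m) choose m) * (\<Sum>k<p. (p - 1 - k) * (k choose (m - 1))\<^sup>2)))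
                      (- of_nat p)"
proof (cases "p < 2 * m")
  case True
  thus ?thesis using assms by (intro central_choose_weighted_square_sum_cong_large)
next
  case False
  moreover have "p \<noteq> 2 * m" using odd_p by auto
  ultimately have "2 * (m - 1 + 1) < p" using assms by auto
  moreover have "2 * (m - 1) + 2 = 2 * m" "m - 1 + 1 = m" using assms by auto
  ultimately show ?thesis
    using central_choose_weighted_square_sum_cong_small[of "m - 1"] by (simp only:)
qed

section \<open>The two congruences for S\<close>

text \<open>With weight \<open>1\<close> the shifted index stops at \<open>p - 2\<close>. The
  complete sum contributes \<open>0\<close>, and the missing square is \<open>1\<close> modulo
  \<open>p\<close>, so each inner product is minus a central coefficient.\<close>

lemma sum_S_over_square_cong:
  "lcong p (\<Sum>k=1..p-1. S k / of_nat k ^ 2)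
     (- (1 / 2 * of_int (Legendre (int p) 3) * poly (bernoulli_poly (p - 2)) (1 / 3)))"
proof -
  have "lcong p (of_nat ((2 * m) choose m) * (\<Sum>k=1..p-1. 1 * of_nat (((k - 1) choose (m - 1))\<^sup>2)))
          (- of_nat ((2 * m) choose m))" if m: "m \<in> {1..p-1}" for m
  proof -
    have "(\<Sum>k<p. rat_of_nat ((k choose (m - 1))\<^sup>2)) = (\<Sum>k<p-1. of_nat ((k choose (m - 1))\<^sup>2)) + of_nat (((p - 1) choose (m - 1))\<^sup>2)"
      using p_gt_0 sum.lessThan_Suc[of "\<lambda>k. rat_of_nat ((k choose (m - 1))\<^sup>2)" "p - 1"] by simp
    moreover have "(\<Sum>k<p-1. rat_of_nat ((k choose (m - 1))\<^sup>2)) = (\<Sum>k=1..p-1. of_nat (((k - 1) choose (m - 1))\<^sup>2))"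
      by (rule sum.reindex_bij_witness[of _ "\<lambda>k. k - 1" Suc]) auto
    ultimately have eq: "of_nat ((2 * m) choose m) * (\<Sum>k=1..p-1. 1 * of_nat (((k - 1) choose (m - 1))\<^sup>2)) =
        of_nat (((2 * m) choose m) * (\<Sum>k<p. (k choose (m - 1))\<^sup>2)) -
        of_nat ((2 * m) choose m) * rat_of_nat ((p - 1) choose (m - 1)) ^ 2"
      by (simp add: algebra_simps)
    have "lcong p (of_nat ((2 * m) choose m) * rat_of_nat ((p - 1) choose (m - 1)) ^ 2)
            (of_nat ((2 * m) choose m) * ((-1) ^ (m - 1)) ^ 2)"
      using m by (intro lcong_scale lcong_power choose_p_pred_cong local_ints_power local_ints_uminus) auto
    moreover have "lcong p (of_nat (((2 * m) choose m) * (\<Sum>k<p. (k choose (m - 1))\<^sup>2))) 0"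
      using m by (intro central_choose_square_sum_cong) auto
    ultimately show ?thesis unfolding eq
      using lcong_diff by (fastforce simp: power_mult[symmetric])
  qed
  hence "lcong p (\<Sum>m=1..p-1. of_nat (2 * m + 1) / of_nat m ^ 2 *
            (of_nat ((2 * m) choose m) * (\<Sum>k=1..p-1. 1 * of_nat (((k - 1) choose (m - 1))\<^sup>2))))
          (\<Sum>m=1..p-1. of_nat (2 * m + 1) / of_nat m ^ 2 * (- of_nat ((2 * m) choose m)))"
    by (intro lcong_sum lcong_scale local_ints_divide_small_power) auto
  also have "(\<Sum>m=1..p-1. of_nat (2 * m + 1) / of_nat m ^ 2 * (- of_nat ((2 * m) choose m))) =
             - (\<Sum>m=1..p-1. rat_of_nat ((2 * m + 1) * ((2 * m) choose m)) / of_nat m ^ 2)"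
    by (simp only: sum_negf of_nat_mult mult_minus_right times_divide_eq_left)
  also have "lcong p \<dots> (- (1 / 2 * of_int (Legendre (int p) 3) * poly (bernoulli_poly (p - 2)) (1 / 3)))"
    by (intro lcong_minus sum_central_choose_cong)
  finally show ?thesis
    using lcong_add[OF H2_p_pred] weighted_sum_S[of "\<lambda>_. 1"] by (fastforce simp: H2_def)
qed

text \<open>The shifted weight \<open>p - 1 - k\<close> vanishes at \<open>k = p - 1\<close>, so the
  inner sum is complete and its product with the central coefficient is \<open>- p\<close>. Only
  harmonic sums remain, which Wolstenholme's theorem and \<open>H2_p_pred\<close> remove.\<close>

lemma weighted_sum_S_cong_0: "lcong (p\<^sup>2) (\<Sum>k=1..p-1. of_nat (p - k) * S k / of_nat k ^ 2) 0"
proof -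
  have "lcong (p\<^sup>2) (of_nat ((2 * m) choose m) * (\<Sum>k=1..p-1. of_nat (p - k) * of_nat (((k - 1) choose (m - 1))\<^sup>2)))
          (- of_nat p)" if m: "m \<in> {1..p-1}" for m
  proof -
    have "(\<Sum>k=1..p-1. of_nat (p - k) * rat_of_nat (((k - 1) choose (m - 1))\<^sup>2)) =
          (\<Sum>k<p-1. of_nat (p - 1 - k) * of_nat ((k choose (m - 1))\<^sup>2))"
      by (rule sum.reindex_bij_witness[of _ Suc "\<lambda>k. k - 1"]) auto
    also have "\<dots> = (\<Sum>k<p. of_nat (p - 1 - k) * of_nat ((k choose (m - 1))\<^sup>2))"
      using p_gt_0 by (intro sum.mono_neutral_left) auto
    finally have eq: "(\<Sum>k=1..p-1. of_nat (p - k) * rat_of_nat (((k - 1) choose (m - 1))\<^sup>2)) =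
        (\<Sum>k<p. of_nat (p - 1 - k) * of_nat ((k choose (m - 1))\<^sup>2))" .
    have "0 < m" "m < p" using m p_gt_0 by auto
    from central_choose_weighted_square_sum_cong[OF this] show ?thesis
      by (simp only: eq of_nat_mult of_nat_sum)
  qed
  hence "lcong (p\<^sup>2) (\<Sum>m=1..p-1. of_nat (2 * m + 1) / of_nat m ^ 2 *
            (of_nat ((2 * m) choose m) * (\<Sum>k=1..p-1. of_nat (p - k) * of_nat (((k - 1) choose (m - 1))\<^sup>2))))
          (\<Sum>m=1..p-1. of_nat (2 * m + 1) / of_nat m ^ 2 * (- of_nat p))"
    by (intro lcong_sum lcong_scale local_ints_divide_small_power) auto
  also have "(\<Sum>m=1..p-1. of_nat (2 * m + 1) / of_nat m ^ 2 * (- of_nat p)) =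
             - (of_nat p * (2 * (\<Sum>m=1..p-1. 1 / rat_of_nat m) + H2 (p - 1)))"
    unfolding H2_def sum_distrib_left sum.distrib[symmetric] sum_negf[symmetric]
    by (intro sum.cong refl) (auto simp: field_simps power2_eq_square)
  also have "lcong (p\<^sup>2) \<dots> (- (of_nat p * (2 * 0 + 0)))"
    by (intro lcong_minus lcong_p_scale lcong_add lcong_scale H2_p_pred
        lcong_p_square_imp[OF sum_inverse_p_square_cong]) auto
  finally have 1: "lcong (p\<^sup>2) (\<Sum>m=1..p-1. of_nat (2 * m + 1) / of_nat m ^ 2 *
            (of_nat ((2 * m) choose m) * (\<Sum>k=1..p-1. of_nat (p - k) * of_nat (((k - 1) choose (m - 1))\<^sup>2)))) 0"
    by simp
  have "(\<Sum>k=1..p-1. of_nat (p - k) / of_nat k ^ 2) = of_nat p * H2 (p - 1) - (\<Sum>k=1..p-1. 1 / rat_of_nat k)"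
    unfolding H2_def sum_distrib_left sum_subtractf[symmetric]
    by (intro sum.cong refl) (auto simp: of_nat_diff field_simps power2_eq_square)
  moreover have "lcong (p\<^sup>2) \<dots> (of_nat p * 0 - 0)"
    by (intro lcong_diff lcong_p_scale H2_p_pred sum_inverse_p_square_cong)
  ultimately have "lcong (p\<^sup>2) (\<Sum>k=1..p-1. of_nat (p - k) / of_nat k ^ 2) 0" by simp
  from lcong_add[OF this 1] show ?thesis
    unfolding weighted_sum_S[of "\<lambda>k. of_nat (p - k)"] by (simp del: of_nat_diff)
qed

lemma sum_S_over_square_local_ints: "(\<Sum>k=1..p-1. S k / of_nat k ^ 2) \<in> local_ints p"
  by (intro local_ints_sum local_ints_divide_small_power S_local_ints) auto

text \<open>Termwise \<open>1 / k - p / k ^ 2 = - (p - k) / k ^ 2\<close>, so the difference is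
  minus the weighted sum.\<close>

lemma rat_cong_sum_S_over:
  "rat_cong p (\<Sum>k=1..p-1. S k / of_nat k) (of_nat p * (\<Sum>k=1..p-1. S k / (of_nat k)\<^sup>2)) (p\<^sup>2)"
proof (rule rat_congI)
  have "(\<Sum>k=1..p-1. S k / of_nat k) - of_nat p * (\<Sum>k=1..p-1. S k / (of_nat k)\<^sup>2) =
        - (\<Sum>k=1..p-1. of_nat (p - k) * S k / of_nat k ^ 2)"
    unfolding sum_distrib_left sum_subtractf[symmetric] sum_negf[symmetric]
    by (intro sum.cong refl) (auto simp: of_nat_diff field_simps power2_eq_square)
  moreover have "lcong (p\<^sup>2) (- (\<Sum>k=1..p-1. of_nat (p - k) * S k / of_nat k ^ 2)) (- 0)"
    by (intro lcong_minus weighted_sum_S_cong_0)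
  ultimately show "lcong (p\<^sup>2) (\<Sum>k=1..p-1. S k / of_nat k) (of_nat p * (\<Sum>k=1..p-1. S k / (of_nat k)\<^sup>2))"
    by (simp only: lcong_def minus_zero diff_zero)
  show "(\<Sum>k=1..p-1. S k / of_nat k) \<in> local_ints p"
    by (intro local_ints_sum local_ints_divide_small S_local_ints) auto
qed (use p_gt_0 sum_S_over_square_local_ints in auto)

lemma rat_cong_sum_S_over_square:
  "rat_cong p (of_nat p * (\<Sum>k=1..p-1. S k / (of_nat k)\<^sup>2))
     (- (of_nat p / 2) * of_int (Legendre (int p) 3) * poly (bernoulli_poly (p - 2)) (1 / 3)) (p\<^sup>2)"
proof (rule rat_congI)
  show *: "lcong (p\<^sup>2) (of_nat p * (\<Sum>k=1..p-1. S k / (of_nat k)\<^sup>2))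
     (- (of_nat p / 2) * of_int (Legendre (int p) 3) * poly (bernoulli_poly (p - 2)) (1 / 3))"
    using lcong_p_scale[OF sum_S_over_square_cong] by (simp add: mult.assoc)
  show a: "of_nat p * (\<Sum>k=1..p-1. S k / (of_nat k)\<^sup>2) \<in> local_ints p"
    by (intro local_ints_mult local_ints_of_nat sum_S_over_square_local_ints)
  \<comment> \<open>Membership is inherited from the left side through the congruence.\<close>
  show "- (of_nat p / 2) * of_int (Legendre (int p) 3) * poly (bernoulli_poly (p - 2)) (1 / 3) \<in> local_ints p"
    using lcong_local_ints[OF lcong_sym[OF *] a] p_gt_0 by simp
qed (use p_gt_0 in auto)

end

theorem theorem1p4:
  shows "(\<forall>n::nat. n > 0 \<longrightarrow>
            1 / (of_nat n)\<^sup>2 * (\<Sum>k=0..n-1. S k)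
              = (\<Sum>k=0..n-1. (of_nat ((n - 1) choose k))\<^sup>2 * catalan k) \<and>
            (\<Sum>k=0..n-1. (of_nat ((n - 1) choose k))\<^sup>2 * catalan k) \<in> \<int> \<and>
            Polynomial.smult (1 / of_nat n) (\<Sum>k=0..n-1. S_poly k) \<in> int_polys) \<and>
         (\<forall>p::nat. prime p \<and> p > 3 \<longrightarrow>
            rat_cong p (\<Sum>k=1..p-1. S k / of_nat k)
                       (of_nat p * (\<Sum>k=1..p-1. S k / (of_nat k)\<^sup>2)) (p\<^sup>2) \<and>
            rat_cong p (of_nat p * (\<Sum>k=1..p-1. S k / (of_nat k)\<^sup>2))
                       (- (of_nat p / 2) * of_int (Legendre (int p) 3)
                          * poly (bernoulli_poly (p - 2)) (1 / 3)) (p\<^sup>2))"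
proof (intro conjI allI impI; (elim conjE)?)
  fix n :: nat assume n: "n > 0"
  show "1 / (of_nat n)\<^sup>2 * (\<Sum>k=0..n-1. S k) = (\<Sum>k=0..n-1. (of_nat ((n - 1) choose k))\<^sup>2 * catalan k)"
    using n by (rule mean_S_eq_catalan_sum)
  show "(\<Sum>k=0..n-1. (of_nat ((n - 1) choose k))\<^sup>2 * catalan k) \<in> \<int>"
    by (intro Ints_sum Ints_mult Ints_power Ints_of_nat catalan_in_Ints)
  show "Polynomial.smult (1 / of_nat n) (\<Sum>k=0..n-1. S_poly k) \<in> int_polys"
    using n by (rule sum_S_poly_int_polys)
next
  fix p :: nat assume "prime p" "p > 3"
  then interpret local_ring_gt_3 p by unfold_locales
  show "rat_cong p (\<Sum>k=1..p-1. S k / of_nat k) (of_nat p * (\<Sum>k=1..p-1. S k / (of_nat k)\<^sup>2)) (p\<^sup>2)"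
    by (rule rat_cong_sum_S_over)
  show "rat_cong p (of_nat p * (\<Sum>k=1..p-1. S k / (of_nat k)\<^sup>2))
          (- (of_nat p / 2) * of_int (Legendre (int p) 3) * poly (bernoulli_poly (p - 2)) (1 / 3)) (p\<^sup>2)"
    by (rule rat_cong_sum_S_over_square)
qed

end
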